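(* Let $N\ge 2$ and let $\{X^i_t\}_{i=1}^N$ evolve according to the finite-$N$ deterministic linear feedback particle filter $$dX^i_t = A m^{(N)}_t\,dt + \mathsf{K}^{(N)}_t\big(dZ_t - C m^{(N)}_t\,dt\big) + G^{(N)}_t\big(X^i_t - m^{(N)}_t\big)dt,\qquad i=1,\dots,N,$$ where $\mathsf{K}^{(N)}_t=\Sigma^{(N)}_tC^\top$, $$G^{(N)}_t = A - \tfrac12\mathsf{K}^{(N)}_tC + \tfrac12\sigma_B\sigma_B^\top(\Sigma^{(N)}_t)^{-1} + \Omega_t(\Sigma^{(N)}_t)^{-1},$$ $\Omega_t$ is any skew-symmetric $d\times d$ matrix, and $m^{(N)}_t,\Sigma^{(N)}_t$ are the empirical mean and covariance of the particles. Assume that $\Sigma^{(N)}_0$ is invertible. Let $\xi^i_t:=X^i_t-m^{(N)}_t$. Then $$dm^{(N)}_t = A m^{(N)}_t\,dt + \mathsf{K}^{(N)}_t\big(dZ_t - C m^{(N)}_t\,dt\big),$$ $$\frac{d\Sigma^{(N)}_t}{dt} = A\Sigma^{(N)}_t + \Sigma^{(N)}_tA^\top + \sigma_B\sigma_B^\top - \Sigma^{(N)}_tC^\top C\,\Sigma^{(N)}_t,$$ $$\frac{d\xi^i_t}{dt} = G^{(N)}_t\xi^i_t .$$ In particular, the equations for $(m^{(N)}_t,\Sigma^{(N)}_t)$ are identical to the Kalman–Bucy filter equations $$dm_t = Am_t\,dt+\Sigma_tC^\top(dZ_t-Cm_t\,dt),\qquad \frac{d\Sigma_t}{dt}=A\Sigma_t+\Sigma_tA^\top+\sigma_B\sigma_B^\top-\Sigma_tC^\top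 C\Sigma_t .$$
   Context: Linear Gaussian filtering model: $dX_t = AX_t\,dt + \sigma_B\,dB_t$, $dZ_t = CX_t\,dt + dW_t$, with hidden state $X_t\in\mathbb{R}^d$, observation $Z_t\in\mathbb{R}^m$, constant matrices $A,C,\sigma_B$ of appropriate dimension, $\{B_t\},\{W_t\}$ mutually independent standard Wiener processes (identity covariance), and $X_0\sim\mathcal N(m_0,\Sigma_0)$ with $\Sigma_0\succ0$, independent of $\{B_t\},\{W_t\}$. Standing assumption (I): $(A,C)$ is detectable and $(A,\sigma_B)$ is stabilizable. The initial particles $X^i_0$ are i.i.d. $\mathcal N(m_0,\Sigma_0)$. The empirical mean and covariance are $$m^{(N)}_t:=\frac1N\sum_{i=1}^N X^i_t,\qquad \Sigma^{(N)}_t:=\frac{1}{N-1}\sum_{i=1}^N (X^i_t-m^{(N)}_t)(X^i_t-m^{(N)}_t)^\top.$$ *)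

theory Defs
  imports "HOL-Probability.Probability"
begin

section \<open>Linear systems\<close>

definition hurwitz :: "real^'n^'n \<Rightarrow> bool" where
  "hurwitz A \<longleftrightarrow>
    (\<forall>l v. v \<noteq> 0 \<and> (\<chi> i j. complex_of_real (A $ i $ j)) *v v = l *s v \<longrightarrow> Re l < 0)"

definition detectable :: "real^'n^'n \<Rightarrow> real^'n^'m \<Rightarrow> bool" where
  "detectable A C \<longleftrightarrow> (\<exists>L :: real^'m^'n. hurwitz (A - L ** C))"

definition stabilizable :: "real^'n^'n \<Rightarrow> real^'p^'n \<Rightarrow> bool" where
  "stabilizable A D \<longleftrightarrow> (\<exists>K :: real^'n^'p. hurwitz (A - D ** K))"

definition pos_def :: "real^'n^'n \<Rightarrow> bool" where
  "pos_def S \<longleftrightarrow> transpose S = S \<and> (\<forall>x. x \<noteq> 0 \<longrightarrow> 0 < x \<bullet> (S *v x))"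

definition skew :: "real^'n^'n \<Rightarrow> bool" where
  "skew R \<longleftrightarrow> transpose R = - R"

section \<open>Gaussian vectors and Wiener processes\<close>

definition mvn_density :: "real^'n \<Rightarrow> real^'n^'n \<Rightarrow> real^'n \<Rightarrow> real" where
  "mvn_density m S x =
    exp (- (1/2) * ((x - m) \<bullet> (matrix_inv S *v (x - m)))) / sqrt ((2 * pi) ^ CARD('n) * det S)"

text \<open>Nondegenerate Gaussian law; only used with a positive definite \<open>S\<close>.\<close>

definition gaussian :: "'w measure \<Rightarrow> ('w \<Rightarrow> real^'n) \<Rightarrow> real^'n \<Rightarrow> real^'n^'n \<Rightarrow> bool" where
  "gaussian M Y m S \<longleftrightarrow> distributed M lborel Y (\<lambda>x. ennreal (mvn_density m S x))"

definition filtered_prob_space :: "'w measure \<Rightarrow> (real \<Rightarrow> 'w measure) \<Rightarrow> bool" where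
  "filtered_prob_space M F \<longleftrightarrow>
    prob_space M \<and> filtration (space M) F \<and> (\<forall>t. subalgebra M (F t))"

text \<open>Processes are indexed by \<open>real\<close>, but only times \<open>t \<ge> 0\<close> are ever used.\<close>

definition adapted :: "(real \<Rightarrow> 'w measure) \<Rightarrow> (real \<Rightarrow> 'w \<Rightarrow> 'v::topological_space) \<Rightarrow> bool" where
  "adapted F Y \<longleftrightarrow> (\<forall>t\<ge>0. Y t \<in> borel_measurable (F t))"

definition continuous_paths :: "'w measure \<Rightarrow> (real \<Rightarrow> 'w \<Rightarrow> 'v::topological_space) \<Rightarrow> bool" where
  "continuous_paths M Y \<longleftrightarrow> (AE \<omega> in M. continuous_on {0..} (\<lambda>t. Y t \<omega>))"

definition generated_events :: "'w measure \<Rightarrow> real set \<Rightarrow> (real \<Rightarrow> 'w \<Rightarrow> 'v::topological_space) \<Rightarrow> 'w set set" where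
  "generated_events M T Y =
    sigma_sets (space M) {Y t -` U \<inter> space M | t U. t \<in> T \<and> U \<in> sets borel}"

definition wiener :: "'w measure \<Rightarrow> (real \<Rightarrow> 'w measure) \<Rightarrow> (real \<Rightarrow> 'w \<Rightarrow> real^'n) \<Rightarrow> bool" where
  "wiener M F W \<longleftrightarrow>
    adapted F W \<and> continuous_paths M W \<and> (AE \<omega> in M. W 0 \<omega> = 0) \<and>
    (\<forall>s t. 0 \<le> s \<and> s < t \<longrightarrow>
      gaussian M (\<lambda>\<omega>. W t \<omega> - W s \<omega>) 0 ((t - s) *\<^sub>R mat 1) \<and>
      prob_space.indep_set M (sets (F s))
        {(\<lambda>\<omega>. W t \<omega> - W s \<omega>) -` U \<inter> space M | U. U \<in> sets borel})"

section \<open>Stochastic integrals and differentials\<close>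

definition partition_upto :: "real \<Rightarrow> nat \<Rightarrow> (nat \<Rightarrow> real) \<Rightarrow> bool" where
  "partition_upto t n p \<longleftrightarrow> p 0 = 0 \<and> p n = t \<and> (\<forall>k<n. p k \<le> p (Suc k))"

definition ito_sum ::
  "(real \<Rightarrow> 'w \<Rightarrow> real^'k^'n) \<Rightarrow> (real \<Rightarrow> 'w \<Rightarrow> real^'k) \<Rightarrow> nat \<Rightarrow> (nat \<Rightarrow> real) \<Rightarrow> 'w \<Rightarrow> real^'n" where
  "ito_sum H U n p \<omega> = (\<Sum>k<n. H (p k) \<omega> *v (U (p (Suc k)) \<omega> - U (p k) \<omega>))"

text \<open>
  \<open>J\<close> is a continuous version of the Ito integral process \<open>\<integral>\<^sub>0\<^sup>t H dU\<close>, for a continuous adapted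
  integrand \<open>H\<close> and a continuous adapted integrator \<open>U\<close>: for every \<open>t\<close>, the left-endpoint sums
  converge in probability to \<open>J t\<close> as the mesh of the (deterministic) partition of \<open>[0,t]\<close> tends to 0.
  \<open>J t\<close> is only asked to be a random variable on \<open>M\<close>, because \<open>F\<close> is not assumed to be complete.
\<close>

definition has_ito_integral ::
  "'w measure \<Rightarrow> (real \<Rightarrow> 'w measure) \<Rightarrow> (real \<Rightarrow> 'w \<Rightarrow> real^'k^'n) \<Rightarrow> (real \<Rightarrow> 'w \<Rightarrow> real^'k) \<Rightarrow>
    (real \<Rightarrow> 'w \<Rightarrow> real^'n) \<Rightarrow> bool" where
  "has_ito_integral M F H U J \<longleftrightarrow>
    adapted F H \<and> continuous_paths M H \<and> adapted F U \<and> continuous_paths M U \<and>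
    (\<forall>t\<ge>0. J t \<in> borel_measurable M) \<and> continuous_paths M J \<and>
    (\<forall>t\<ge>0. \<forall>\<epsilon>>0. \<forall>\<eta>>0. \<exists>\<delta>>0. \<forall>n p.
      partition_upto t n p \<and> (\<forall>k<n. p (Suc k) - p k < \<delta>) \<longrightarrow>
      measure M {\<omega> \<in> space M. norm (ito_sum H U n p \<omega> - J t \<omega>) > \<epsilon>} < \<eta>)"

text \<open>The stochastic differential \<open>dY\<^sub>t = a\<^sub>t dt + H\<^sub>t dU\<^sub>t\<close> on \<open>[0,\<infinity>)\<close>.\<close>

definition has_ito_differential ::
  "'w measure \<Rightarrow> (real \<Rightarrow> 'w measure) \<Rightarrow> (real \<Rightarrow> 'w \<Rightarrow> real^'n) \<Rightarrow> (real \<Rightarrow> 'w \<Rightarrow> real^'n) \<Rightarrow>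
    (real \<Rightarrow> 'w \<Rightarrow> real^'k^'n) \<Rightarrow> (real \<Rightarrow> 'w \<Rightarrow> real^'k) \<Rightarrow> bool" where
  "has_ito_differential M F Y a H U \<longleftrightarrow>
    adapted F Y \<and> continuous_paths M Y \<and>
    (\<exists>J. has_ito_integral M F H U J \<and>
      (AE \<omega> in M. \<forall>t\<ge>0.
        (\<lambda>s. a s \<omega>) absolutely_integrable_on {0..t} \<and>
        Y t \<omega> = Y 0 \<omega> + integral {0..t} (\<lambda>s. a s \<omega>) + J t \<omega>))"

section \<open>The filtering model\<close>

definition linear_gaussian_model ::
  "'w measure \<Rightarrow> (real \<Rightarrow> 'w measure) \<Rightarrow> real^'d^'d \<Rightarrow> real^'d^'m \<Rightarrow> real^'p^'d \<Rightarrow>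
    real^'d \<Rightarrow> real^'d^'d \<Rightarrow> (real \<Rightarrow> 'w \<Rightarrow> real^'p) \<Rightarrow> (real \<Rightarrow> 'w \<Rightarrow> real^'m) \<Rightarrow>
    (real \<Rightarrow> 'w \<Rightarrow> real^'d) \<Rightarrow> (real \<Rightarrow> 'w \<Rightarrow> real^'m) \<Rightarrow> bool" where
  "linear_gaussian_model M F A C \<sigma>\<^sub>B m\<^sub>0 \<Sigma>\<^sub>0 B W X Z \<longleftrightarrow>
    filtered_prob_space M F \<and> wiener M F B \<and> wiener M F W \<and>
    prob_space.indep_sets M
      (\<lambda>j::nat. if j = 0 then generated_events M {0} X
                else if j = 1 then generated_events M {0..} B
                else generated_events M {0..} W) {0, 1, 2} \<and>
    pos_def \<Sigma>\<^sub>0 \<and> gaussian M (X 0) m\<^sub>0 \<Sigma>\<^sub>0 \<and>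
    has_ito_differential M F X (\<lambda>t \<omega>. A *v X t \<omega>) (\<lambda>t \<omega>. \<sigma>\<^sub>B) B \<and>
    has_ito_differential M F Z (\<lambda>t \<omega>. C *v X t \<omega>) (\<lambda>t \<omega>. mat 1) W"

definition gain :: "real^'d^'m \<Rightarrow> real^'d^'d \<Rightarrow> real^'m^'d" where
  "gain C S = S ** transpose C"

definition riccati :: "real^'d^'d \<Rightarrow> real^'d^'m \<Rightarrow> real^'p^'d \<Rightarrow> real^'d^'d \<Rightarrow> real^'d^'d" where
  "riccati A C \<sigma>\<^sub>B S =
    A ** S + S ** transpose A + \<sigma>\<^sub>B ** transpose \<sigma>\<^sub>B - S ** transpose C ** C ** S"

text \<open>
  The Kalman--Bucy equations for a pair \<open>(m, S)\<close> driven by \<open>Z\<close>, without initial conditions.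
  \<open>S\<close> may be random, since the empirical covariance of particles is.
\<close>

definition kalman_bucy_equations ::
  "'w measure \<Rightarrow> (real \<Rightarrow> 'w measure) \<Rightarrow> real^'d^'d \<Rightarrow> real^'d^'m \<Rightarrow> real^'p^'d \<Rightarrow>
    (real \<Rightarrow> 'w \<Rightarrow> real^'m) \<Rightarrow> (real \<Rightarrow> 'w \<Rightarrow> real^'d) \<Rightarrow> (real \<Rightarrow> 'w \<Rightarrow> real^'d^'d) \<Rightarrow> bool" where
  "kalman_bucy_equations M F A C \<sigma>\<^sub>B Z m S \<longleftrightarrow>
    has_ito_differential M F m
      (\<lambda>t \<omega>. A *v m t \<omega> - gain C (S t \<omega>) *v (C *v m t \<omega>)) (\<lambda>t \<omega>. gain C (S t \<omega>)) Z \<and>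
    (AE \<omega> in M. \<forall>t\<ge>0.
      ((\<lambda>s. S s \<omega>) has_vector_derivative riccati A C \<sigma>\<^sub>B (S t \<omega>)) (at t within {0..}))"

section \<open>Particles\<close>

definition outer :: "real^'d \<Rightarrow> real^'d \<Rightarrow> real^'d^'d" where
  "outer v w = (\<chi> i j. v $ i * w $ j)"

text \<open>The particles are \<open>X 1, \<dots>, X N\<close>.\<close>

definition emp_mean :: "nat \<Rightarrow> (nat \<Rightarrow> real \<Rightarrow> 'w \<Rightarrow> real^'d) \<Rightarrow> real \<Rightarrow> 'w \<Rightarrow> real^'d" where
  "emp_mean N X t \<omega> = (1 / real N) *\<^sub>R (\<Sum>i=1..N. X i t \<omega>)"

definition deviation :: "nat \<Rightarrow> (nat \<Rightarrow> real \<Rightarrow> 'w \<Rightarrow> real^'d) \<Rightarrow> nat \<Rightarrow> real \<Rightarrow> 'w \<Rightarrow> real^'d" where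
  "deviation N X i t \<omega> = X i t \<omega> - emp_mean N X t \<omega>"

definition emp_cov :: "nat \<Rightarrow> (nat \<Rightarrow> real \<Rightarrow> 'w \<Rightarrow> real^'d) \<Rightarrow> real \<Rightarrow> 'w \<Rightarrow> real^'d^'d" where
  "emp_cov N X t \<omega> =
    (1 / (real N - 1)) *\<^sub>R (\<Sum>i=1..N. outer (deviation N X i t \<omega>) (deviation N X i t \<omega>))"

definition flow_matrix ::
  "real^'d^'d \<Rightarrow> real^'d^'m \<Rightarrow> real^'p^'d \<Rightarrow> real^'d^'d \<Rightarrow> real^'d^'d \<Rightarrow> real^'d^'d" where
  "flow_matrix A C \<sigma>\<^sub>B S R =
    A - (1/2) *\<^sub>R (gain C S ** C) + (1/2) *\<^sub>R (\<sigma>\<^sub>B ** transpose \<sigma>\<^sub>B ** matrix_inv S)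
      + R ** matrix_inv S"

end

theory Submission
  imports Defs
begin

text \<open>
  The argument has a probabilistic and a pathwise half.

  All particles are driven by the same stochastic integral \<open>\<integral> K dZ\<close>. Each particle equation comes with
  its own version of it, but two versions are limits in probability of the same sums and hence
  indistinguishable (\<open>has_ito_integral_unique\<close>). Averaging the particle equations
  (\<open>has_ito_differential_average\<close>) therefore gives the equation of the empirical mean: the feedback
  term \<open>G (X\<^sub>i - m)\<close> drops out because the deviations sum to zero. Subtracting the mean from a particle
  cancels the stochastic integral altogether (\<open>ito_differential_difference\<close>), so that for almost every
  outcome the deviations solve \<open>\<xi>\<^sub>i t = \<xi>\<^sub>i 0 + \<integral>\<^sub>0\<^sup>t G \<xi>\<^sub>i\<close>, an ordinary integral equation.

  The rest is deterministic (\<open>deviation_flow\<close>). The coefficients are merely integrable in time, so the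
  equation \<open>S' = G S + S G\<^sup>T\<close> for the empirical covariance is derived from a product rule for
  indefinite integrals. Where \<open>S\<close> is invertible its right-hand side is exactly the Riccati field: the
  skew term cancels (\<open>flow_matrix_lyapunov\<close>). As this field is continuous along the path, \<open>S\<close> is
  continuously differentiable there.

  The delicate point is that \<open>G\<close> contains \<open>S\<^sup>-\<^sup>1\<close>, while \<open>S\<close> is known to be invertible only at time \<open>0\<close>.
  Up to the first singular time the Riccati equation is available, and it implies a linear differential
  inequality for the trace of \<open>S\<^sup>-\<^sup>1\<close>. By Gronwall this trace cannot blow up in finite time, so there is
  no singular time (\<open>riccati_solution_stays_invertible\<close>). Finally, the differential form of the
  deviation equation follows at almost every time from Lebesgue's differentiation theorem, and at every
  time of continuity of the skew matrices from continuity of the integrand.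
\<close>

section \<open>Matrix calculus\<close>

lemma tendsto_matrix_mult:
  fixes f :: "'a \<Rightarrow> real^'n^'m" and g :: "'a \<Rightarrow> real^'k^'n"
  assumes "(f \<longlongrightarrow> A) F" "(g \<longlongrightarrow> B) F"
  shows "((\<lambda>x. f x ** g x) \<longlongrightarrow> A ** B) F"
  unfolding matrix_matrix_mult_def
  by (intro vec_tendstoI) (auto intro!: tendsto_intros assms)

lemma tendsto_matrix_vector_mult:
  fixes f :: "'a \<Rightarrow> real^'n^'m" and g :: "'a \<Rightarrow> real^'n"
  assumes "(f \<longlongrightarrow> A) F" "(g \<longlongrightarrow> v) F"
  shows "((\<lambda>x. f x *v g x) \<longlongrightarrow> A *v v) F"
  unfolding matrix_vector_mult_def
  by (intro vec_tendstoI) (auto intro!: tendsto_intros assms)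

lemma tendsto_trace:
  fixes f :: "'a \<Rightarrow> real^'n^'n"
  assumes "(f \<longlongrightarrow> A) F"
  shows "((\<lambda>x. trace (f x)) \<longlongrightarrow> trace A) F"
  unfolding trace_def by (auto intro!: tendsto_intros assms)

lemma tendsto_outer:
  fixes f g :: "'a \<Rightarrow> real^'n"
  assumes "(f \<longlongrightarrow> v) F" "(g \<longlongrightarrow> w) F"
  shows "((\<lambda>x. outer (f x) (g x)) \<longlongrightarrow> outer v w) F"
  unfolding outer_def by (intro vec_tendstoI) (auto intro!: tendsto_intros assms)

lemma tendsto_det:
  fixes f :: "'a \<Rightarrow> real^'n^'n"
  assumes "(f \<longlongrightarrow> A) F"
  shows "((\<lambda>x. det (f x)) \<longlongrightarrow> det A) F"
  unfolding det_def by (intro tendsto_intros assms)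

lemma matrix_inv_inverse:
  fixes A :: "real^'n^'n"
  assumes "invertible A"
  shows "A ** matrix_inv A = mat 1" "matrix_inv A ** A = mat 1"
  using someI_ex[OF assms[unfolded invertible_def]] unfolding matrix_inv_def by auto

text \<open>
  Cramer's rule for the columns of the inverse. It exhibits the inverse as a continuous function of
  the matrix.
\<close>

lemma matrix_inv_component:
  fixes A :: "real^'n^'n"
  assumes "invertible A"
  shows "matrix_inv A $ i $ j =
    det (\<chi> a b. if b = i then axis j 1 $ a else A $ a $ b) / det A"
proof -
  have "A *v (matrix_inv A *v axis j 1) = axis j 1"
    by (simp add: matrix_vector_mul_assoc matrix_inv_inverse assms)
  then have "matrix_inv A *v axis j 1 =
      (\<chi> k. det (\<chi> a b. if b = k then axis j 1 $ a else A $ a $ b) / det A)"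
    using assms by (subst (asm) cramer) (auto simp: invertible_det_nz)
  then have "(matrix_inv A *v axis j 1) $ i =
      det (\<chi> a b. if b = i then axis j 1 $ a else A $ a $ b) / det A"
    by simp
  then show ?thesis
    by (simp add: matrix_vector_mul_component inner_axis)
qed

lemma tendsto_matrix_inv:
  fixes f :: "'a \<Rightarrow> real^'n^'n"
  assumes f: "(f \<longlongrightarrow> A) F" and A: "invertible A"
  shows "((\<lambda>x. matrix_inv (f x)) \<longlongrightarrow> matrix_inv A) F"
proof (intro vec_tendstoI)
  fix i j
  have d: "det A \<noteq> 0" using A by (simp add: invertible_det_nz)
  have ev: "\<forall>\<^sub>F x in F. invertible (f x)"
    using tendsto_imp_eventually_ne[OF tendsto_det[OF f] d] by (simp add: invertible_det_nz)
  have "((\<lambda>x. det (\<chi> a b. if b = i then axis j 1 $ a else f x $ a $ b) / det (f x)) \<longlongrightarrow>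
      det (\<chi> a b. if b = i then axis j 1 $ a else A $ a $ b) / det A) F"
  proof (intro tendsto_divide tendsto_det f d vec_tendstoI)
    fix a b
    show "((\<lambda>x. (\<chi> a b. if b = i then axis j 1 $ a else f x $ a $ b) $ a $ b) \<longlongrightarrow>
        (\<chi> a b. if b = i then axis j 1 $ a else A $ a $ b) $ a $ b) F"
      by (cases "b = i") (auto intro!: tendsto_intros f)
  qed
  then show "((\<lambda>x. matrix_inv (f x) $ i $ j) \<longlongrightarrow> matrix_inv A $ i $ j) F"
    by (subst tendsto_cong[OF eventually_mono[OF ev matrix_inv_component]])
       (auto simp: matrix_inv_component A)
qed

definition psd :: "real^'n^'n \<Rightarrow> bool" where
  "psd S \<longleftrightarrow> transpose S = S \<and> (\<forall>x. 0 \<le> x \<bullet> (S *v x))"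

lemma psd_matrix_inv:
  fixes S :: "real^'n^'n"
  assumes "psd S" "invertible S"
  shows "psd (matrix_inv S)"
proof -
  let ?P = "matrix_inv S"
  note i = matrix_inv_inverse[OF assms(2)]
  have sym: "transpose S = S" using assms by (simp add: psd_def)
  have "transpose ?P ** S = mat 1"
    using arg_cong[OF i(1), of transpose] by (simp add: matrix_transpose_mul sym transpose_mat)
  then have t: "transpose ?P = ?P"
    by (metis i(1) matrix_mul_assoc matrix_mul_lid matrix_mul_rid)
  have "0 \<le> x \<bullet> (?P *v x)" for x
  proof -
    have "x \<bullet> (?P *v x) = (?P *v x) \<bullet> (S *v (?P *v x))"
      by (simp add: matrix_vector_mul_assoc i inner_commute)
    then show ?thesis using assms by (simp add: psd_def)
  qed
  with t show ?thesis by (simp add: psd_def)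
qed

lemma psd_diag_nonneg: "psd P \<Longrightarrow> 0 \<le> P $ i $ i"
  unfolding psd_def by (metis inner_axis' inner_axis column_def matrix_vector_mult_basis vec_lambda_beta mult_1 inner_real_def mult.commute)

text \<open>
  Test vectors \<open>e\<^sub>i \<plusminus> e\<^sub>j\<close> give \<open>2 \<bar>P\<^sub>i\<^sub>j\<bar> \<le> P\<^sub>i\<^sub>i + P\<^sub>j\<^sub>j\<close>. Thus the trace serves as a norm on positive
  semidefinite matrices, and, unlike an operator norm, one that is differentiable.
\<close>

lemma psd_component_le_trace:
  fixes P :: "real^'n^'n"
  assumes "psd P"
  shows "\<bar>P $ i $ j\<bar> \<le> trace P"
proof -
  have sym: "P $ j $ i = P $ i $ j"
    using assms unfolding psd_def transpose_def by (metis vec_lambda_beta)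
  have q: "0 \<le> P $ i $ i + P $ j $ j + 2 * e * P $ i $ j" if "e\<^sup>2 = 1" for e :: real
  proof -
    have "0 \<le> (axis i 1 + e *\<^sub>R axis j 1) \<bullet> (P *v (axis i 1 + e *\<^sub>R axis j 1))"
      using assms by (simp add: psd_def)
    also have "\<dots> = P $ i $ i + e * P $ i $ j + e * P $ j $ i + e\<^sup>2 * P $ j $ j"
      by (simp add: matrix_vector_right_distrib matrix_vector_mult_scaleR inner_add_left
          inner_add_right inner_axis' matrix_vector_mul_component inner_axis algebra_simps power2_eq_square)
    finally show ?thesis using sym that by simp
  qed
  have le: "P $ k $ k \<le> trace P" for k
    unfolding trace_def using psd_diag_nonneg[OF assms]
    by (intro member_le_sum) auto
  have "2 * \<bar>P $ i $ j\<bar> \<le> P $ i $ i + P $ j $ j"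
    using q[of 1] q[of "-1"] by auto
  then show ?thesis using le[of i] le[of j] by linarith
qed

lemma psd_trace_nonneg: "psd P \<Longrightarrow> 0 \<le> trace P"
  unfolding trace_def by (intro sum_nonneg psd_diag_nonneg)

lemma abs_trace_psd_mult_le:
  fixes P A :: "real^'n^'n"
  assumes "psd P"
  shows "\<bar>trace (P ** A)\<bar> \<le> (\<Sum>i\<in>UNIV. \<Sum>k\<in>UNIV. \<bar>A $ k $ i\<bar>) * trace P"
proof -
  have "\<bar>trace (P ** A)\<bar> \<le> (\<Sum>i\<in>UNIV. \<Sum>k\<in>UNIV. \<bar>P $ i $ k * A $ k $ i\<bar>)"
    unfolding trace_def matrix_matrix_mult_def
    by (simp, intro order_trans[OF sum_abs] sum_mono order_refl)
  also have "\<dots> \<le> (\<Sum>i\<in>UNIV. \<Sum>k\<in>UNIV. \<bar>A $ k $ i\<bar> * trace P)"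
    unfolding abs_mult by (intro sum_mono) (metis abs_ge_zero mult.commute mult_left_mono psd_component_le_trace assms)
  finally show ?thesis by (simp add: sum_distrib_right)
qed

lemma trace_mult_transpose_nonneg: "0 \<le> trace (B ** transpose B)" for B :: "real^'k^'n"
  unfolding trace_def matrix_matrix_mult_def transpose_def by (auto intro!: sum_nonneg)

lemma matrix_diff_ldistrib: "A ** (B - C) = A ** B - A ** C" for A :: "real^'n^'m"
  by (simp add: vec_eq_iff matrix_matrix_mult_def algebra_simps sum_subtractf)

lemma matrix_diff_rdistrib: "(B - C) ** A = B ** A - C ** A" for A :: "real^'n^'m"
  by (simp add: vec_eq_iff matrix_matrix_mult_def algebra_simps sum_subtractf)

lemma matrix_add_rdistrib: "(B + C) ** A = B ** A + C ** A" for A :: "real^'n^'m"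
  by (simp add: vec_eq_iff matrix_matrix_mult_def algebra_simps sum.distrib)

lemma matrix_scaleR_ldistrib: "A ** (c *\<^sub>R B) = c *\<^sub>R (A ** B)" for A :: "real^'n^'m"
  by (simp add: vec_eq_iff matrix_matrix_mult_def algebra_simps sum_distrib_left)

lemma matrix_scaleR_rdistrib: "(c *\<^sub>R B) ** A = c *\<^sub>R (B ** A)" for A :: "real^'n^'m"
  by (simp add: vec_eq_iff matrix_matrix_mult_def algebra_simps sum_distrib_left)

text \<open>
  The identity \<open>P s - P t = - P s (S s - S t) P t\<close> for \<open>P = S\<^sup>-\<^sup>1\<close> reduces the difference quotient of the
  inverse to that of \<open>S\<close> and to the continuity of inversion.
\<close>

lemma DERIV_trace_matrix_inv:
  fixes S :: "real \<Rightarrow> real^'n^'n"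
  assumes S: "(S has_vector_derivative D) (at t within X)" and inv: "invertible (S t)"
  shows "((\<lambda>s. trace (matrix_inv (S s))) has_real_derivative
      - trace (matrix_inv (S t) ** D ** matrix_inv (S t))) (at t within X)"
proof -
  let ?P = "\<lambda>s. matrix_inv (S s)"
  let ?q = "\<lambda>s. (1 / (s - t)) *\<^sub>R (S s - S t)"
  have cS: "(S \<longlongrightarrow> S t) (at t within X)"
    using has_vector_derivative_continuous[OF S] by (simp add: continuous_within)
  have q: "(?q \<longlongrightarrow> D) (at t within X)"
  proof (intro vec_tendstoI)
    fix a b
    have "((\<lambda>s. S s $ a $ b) has_real_derivative D $ a $ b) (at t within X)"
      using bounded_linear.has_vector_derivative[OF bounded_linear_vec_nth
        bounded_linear.has_vector_derivative[OF bounded_linear_vec_nth S]]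
      by (simp add: has_real_derivative_iff_has_vector_derivative)
    then show "((\<lambda>s. ?q s $ a $ b) \<longlongrightarrow> D $ a $ b) (at t within X)"
      by (simp add: has_field_derivative_iff divide_inverse mult.commute)
  qed
  have lim: "((\<lambda>s. - trace (?P s ** ?q s ** ?P t)) \<longlongrightarrow> - trace (?P t ** D ** ?P t)) (at t within X)"
    by (intro tendsto_minus tendsto_trace tendsto_matrix_mult tendsto_matrix_inv cS q inv tendsto_const)
  have ev: "\<forall>\<^sub>F s in at t within X. invertible (S s)"
    using tendsto_imp_eventually_ne[OF tendsto_det[OF cS], of 0] inv by (simp add: invertible_det_nz)
  have "\<forall>\<^sub>F s in at t within X. - trace (?P s ** ?q s ** ?P t) = (trace (?P s) - trace (?P t)) / (s - t)"
    using ev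
  proof eventually_elim
    case (elim s)
    have "?P s ** (S s - S t) ** ?P t = ?P s ** S s ** ?P t - ?P s ** (S t ** ?P t)"
      by (simp add: matrix_diff_ldistrib matrix_diff_rdistrib matrix_mul_assoc)
    also have "\<dots> = ?P t - ?P s"
      by (simp add: matrix_inv_inverse elim inv)
    finally have "trace (?P s ** ?q s ** ?P t) = trace ((1 / (s - t)) *\<^sub>R (?P t - ?P s))"
      by (simp add: matrix_scaleR_ldistrib matrix_scaleR_rdistrib)
    also have "\<dots> = (trace (?P t) - trace (?P s)) / (s - t)"
      by (simp add: trace_def sum_subtractf sum_divide_distrib diff_divide_distrib)
    finally show ?case by (simp add: field_simps minus_divide_left)
  qed
  with lim show ?thesis
    unfolding has_field_derivative_iff by (simp add: tendsto_cong)
qed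

section \<open>Indefinite integrals\<close>

text \<open>
  If the increments of \<open>D\<close> over short intervals are small even relative to those of \<open>V\<close>, then
  summing them over a fine partition bounds \<open>D T - D 0\<close> by an arbitrarily small multiple of
  \<open>V T - V 0\<close>.
\<close>

lemma eq_of_increments_dominated:
  fixes D :: "real \<Rightarrow> 'a::real_normed_vector" and V :: "real \<Rightarrow> real"
  assumes T: "0 \<le> T"
    and dom: "\<And>e. 0 < e \<Longrightarrow> \<exists>d>0. \<forall>s t. 0 \<le> s \<and> s \<le> t \<and> t \<le> T \<and> t - s < d \<longrightarrow>
      norm (D t - D s) \<le> e * (V t - V s)"
  shows "D T = D 0"
proof -
  have le: "norm (D T - D 0) \<le> e * (V T - V 0)" if e: "0 < e" for e
  proof -
    obtain d where d: "d > 0" "\<And>s t. \<lbrakk>0 \<le> s; s \<le> t; t \<le> T; t - s < d\<rbrakk> \<Longrightarrow>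
        norm (D t - D s) \<le> e * (V t - V s)"
      using dom[OF e] by blast
    obtain n :: nat where n: "T / d < n" using reals_Archimedean2 by blast
    have n0: "0 < real n" using n T d by (meson divide_nonneg_pos le_less_trans)
    define p where "p k = real k * (T / n)" for k :: nat
    have p: "p 0 = 0" "p n = T" using n0 by (auto simp: p_def)
    have step: "p (Suc k) - p k = T / n" for k by (simp add: p_def algebra_simps add_divide_distrib)
    have mesh: "T / n < d" using n d n0 by (simp add: field_simps)
    have "D T - D 0 = (\<Sum>k<n. D (p (Suc k)) - D (p k))"
      using p by (subst sum_lessThan_telescope) simp
    then have "norm (D T - D 0) \<le> (\<Sum>k<n. norm (D (p (Suc k)) - D (p k)))"
      using norm_sum by metis
    also have "\<dots> \<le> (\<Sum>k<n. e * (V (p (Suc k)) - V (p k)))"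
    proof (intro sum_mono d)
      fix k assume "k \<in> {..<n}"
      then have "real (Suc k) * (T / n) \<le> real n * (T / n)"
        using T n0 by (intro mult_right_mono) auto
      then show "p (Suc k) \<le> T" using p(2) by (simp add: p_def)
      show "0 \<le> p k" "p k \<le> p (Suc k)" "p (Suc k) - p k < d"
        using T n0 step[of k] mesh by (auto simp: p_def intro!: divide_right_mono mult_right_mono)
    qed
    also have "\<dots> = e * (V T - V 0)"
      unfolding sum_distrib_left[symmetric] using p by (subst sum_lessThan_telescope) simp
    finally show ?thesis .
  qed
  have "norm (D T - D 0) \<le> 0"
  proof (rule ccontr)
    assume "\<not> ?thesis"
    then have n: "0 < norm (D T - D 0)" by simp
    moreover have "norm (D T - D 0) \<le> V T - V 0" using le[of 1] by simp
    ultimately have c: "0 < V T - V 0" by linarith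
    show False using le[of "norm (D T - D 0) / (2 * (V T - V 0))"] n c by (simp add: field_simps)
  qed
  then show ?thesis by simp
qed

text \<open>
  The product rule for absolutely continuous functions. Their derivatives exist only almost
  everywhere, so the proof avoids them: over \<open>[s, t]\<close> the difference of the two sides has the
  increment \<open>\<integral> (x s - x r) v r + (y t - y r) u r dr\<close>, which uniform continuity makes small relative to
  \<open>\<integral> \<bar>u\<bar> + \<bar>v\<bar>\<close>.
\<close>

lemma has_integral_product_of_indefinite_integrals:
  fixes x y u v :: "real \<Rightarrow> real"
  assumes T: "0 \<le> T"
    and u: "u absolutely_integrable_on {0..T}" and v: "v absolutely_integrable_on {0..T}"
    and x: "\<And>t. t \<in> {0..T} \<Longrightarrow> x t = x 0 + integral {0..t} u"
    and y: "\<And>t. t \<in> {0..T} \<Longrightarrow> y t = y 0 + integral {0..t} v"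
  shows "((\<lambda>s. x s * v s + u s * y s) has_integral x T * y T - x 0 * y 0) {0..T}"
proof -
  let ?f = "\<lambda>s. x s * v s + u s * y s"
  let ?w = "\<lambda>s. \<bar>u s\<bar> + \<bar>v s\<bar>"
  have iu: "u integrable_on {0..T}" and iv: "v integrable_on {0..T}"
    using u v by (auto simp: absolutely_integrable_on_def)
  have iw: "?w integrable_on {0..T}"
    using u v by (auto simp: absolutely_integrable_on_def intro!: integrable_add)
  have cx: "continuous_on {0..T} x"
    by (subst continuous_on_cong[OF refl x]) (auto intro!: continuous_intros indefinite_integral_continuous_1 iu)
  have cy: "continuous_on {0..T} y"
    by (subst continuous_on_cong[OF refl y]) (auto intro!: continuous_intros indefinite_integral_continuous_1 iv)
  have prod: "(\<lambda>s. h s * g s) integrable_on {a..b}"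
    if "continuous_on {0..T} h" "g absolutely_integrable_on {0..T}" "0 \<le> a" "b \<le> T" for h g :: "real \<Rightarrow> real" and a b
  proof -
    have "(\<lambda>s. h s * g s) absolutely_integrable_on {0..T}"
      using that
      by (intro absolutely_integrable_bounded_measurable_product_real continuous_imp_measurable_on_sets_lebesgue
          compact_imp_bounded compact_continuous_image) auto
    then show ?thesis
      using that integrable_on_subinterval[of _ "{0..T}" a b]
      by (auto simp: absolutely_integrable_on_def)
  qed
  have iff: "?f integrable_on {a..b}" if "0 \<le> a" "b \<le> T" for a b
    using prod[OF cx v that] prod[OF cy u that] by (auto intro!: integrable_add simp: mult.commute)
  have incr: "integral {s..t} g = integral {0..t} g - integral {0..s} g"
    if "g integrable_on {0..T}" "0 \<le> s" "s \<le> t" "t \<le> T" for g :: "real \<Rightarrow> real" and s t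
    using that Henstock_Kurzweil_Integration.integral_combine[of 0 s t g]
      integrable_on_subinterval[of g "{0..T}" 0 t] by auto
  define D where "D t = x t * y t - integral {0..t} ?f" for t
  have "D T = D 0"
  proof (rule eq_of_increments_dominated[where V = "\<lambda>t. integral {0..t} ?w", OF T])
    fix e :: real assume e: "0 < e"
    obtain d1 where d1: "d1 > 0" "\<forall>s\<in>{0..T}. \<forall>t\<in>{0..T}. dist t s < d1 \<longrightarrow> dist (x t) (x s) < e"
      using compact_uniformly_continuous[OF cx compact_Icc] e
      unfolding uniformly_continuous_on_def by blast
    obtain d2 where d2: "d2 > 0" "\<forall>s\<in>{0..T}. \<forall>t\<in>{0..T}. dist t s < d2 \<longrightarrow> dist (y t) (y s) < e"
      using compact_uniformly_continuous[OF cy compact_Icc] e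
      unfolding uniformly_continuous_on_def by blast
    have "norm (D t - D s) \<le> e * (integral {0..t} ?w - integral {0..s} ?w)"
      if st: "0 \<le> s" "s \<le> t" "t \<le> T" "t - s < min d1 d2" for s t
    proof -
      have sub: "{s..t} \<subseteq> {0..T}" using st by auto
      have i: "u integrable_on {s..t}" "v integrable_on {s..t}" "?w integrable_on {s..t}"
        using integrable_on_subinterval[OF _ sub] iu iv iw by auto
      have ix: "integral {s..t} u = x t - x s" and iy: "integral {s..t} v = y t - y s"
        using incr[OF iu st(1-3)] incr[OF iv st(1-3)] x[of s] x[of t] y[of s] y[of t] st by auto
      have i': "(\<lambda>r. x s * v r) integrable_on {s..t}" "(\<lambda>r. y t * u r) integrable_on {s..t}"
        using i by (simp_all add: integrable_on_mult_right)
      note i'' = integrable_add[OF i']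
      have ifst: "?f integrable_on {s..t}" by (rule iff[OF st(1) st(3)])
      have "D t - D s = x t * y t - x s * y s - integral {s..t} ?f"
        unfolding D_def using incr[OF iff[of 0 T] st(1-3)] by simp
      also have "x t * y t - x s * y s = integral {s..t} (\<lambda>r. x s * v r + y t * u r)"
        unfolding integral_add[OF i'] by (simp add: ix iy) (simp add: algebra_simps)
      also have "\<dots> - integral {s..t} ?f = integral {s..t} (\<lambda>r. (x s * v r + y t * u r) - ?f r)"
        by (rule integral_diff[OF i'' ifst, symmetric])
      also have "norm \<dots> \<le> integral {s..t} (\<lambda>r. e * ?w r)"
      proof (rule integral_norm_bound_integral)
        show "(\<lambda>r. (x s * v r + y t * u r) - ?f r) integrable_on {s..t}"
          by (rule integrable_diff[OF i'' ifst])
        show "(\<lambda>r. e * ?w r) integrable_on {s..t}" by (rule integrable_on_mult_right[OF i(3)])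
        fix r assume r: "r \<in> {s..t}"
        have "\<bar>x s - x r\<bar> \<le> e" "\<bar>y t - y r\<bar> \<le> e"
          using d1(2)[rule_format, of r s] d2(2)[rule_format, of r t] r st by (auto simp: dist_real_def)
        then have "\<bar>(x s - x r) * v r\<bar> \<le> e * \<bar>v r\<bar>" "\<bar>(y t - y r) * u r\<bar> \<le> e * \<bar>u r\<bar>"
          unfolding abs_mult by (auto intro!: mult_right_mono)
        then show "norm ((x s * v r + y t * u r) - ?f r) \<le> e * ?w r"
          using abs_triangle_ineq[of "(x s - x r) * v r" "(y t - y r) * u r"]
          by (simp add: algebra_simps)
      qed
      also have "\<dots> = e * (integral {0..t} ?w - integral {0..s} ?w)"
        using incr[OF iw st(1-3)] by simp
      finally show ?thesis .
    qed
    then show "\<exists>d>0. \<forall>s t. 0 \<le> s \<and> s \<le> t \<and> t \<le> T \<and> t - s < d \<longrightarrow>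
        norm (D t - D s) \<le> e * (integral {0..t} ?w - integral {0..s} ?w)"
      using d1(1) d2(1) by (intro exI[of _ "min d1 d2"]) auto
  qed
  then have "integral {0..T} ?f = x T * y T - x 0 * y 0" by (simp add: D_def)
  with iff[of 0 T] show ?thesis by (simp add: has_integral_integrable_integral)
qed

lemma forward_averages_tendsto_AE:
  fixes f :: "real \<Rightarrow> 'b::euclidean_space"
  assumes "\<And>a b. f integrable_on {a..b}"
  shows "\<exists>N. negligible N \<and> (\<forall>t e. t \<notin> N \<longrightarrow> 0 < e \<longrightarrow>
      (\<exists>d>0. \<forall>h. 0 < h \<and> h < d \<longrightarrow> norm (integral {t..t + h} f /\<^sub>R h - f t) < e))"
proof -
  have "\<And>a b. f integrable_on cbox a b" using assms by simp
  from integrable_ccontinuous_explicit[OF this] obtain N where N: "negligible N"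
    "\<And>x e. \<lbrakk>x \<notin> N; 0 < e\<rbrakk> \<Longrightarrow> \<exists>d>0. \<forall>h. 0 < h \<and> h < d \<longrightarrow>
        norm (integral (cbox x (x + h *\<^sub>R One)) f /\<^sub>R h ^ DIM(real) - f x) < e"
    by blast
  show ?thesis using N(2) by (intro exI[of _ N] conjI N(1)) (simp add: cbox_interval)
qed

text \<open>
  Lebesgue's differentiation theorem in one variable. The averages over intervals to the right of
  \<open>t\<close> converge for almost every \<open>t\<close>; applied to the reflected function, the same fact controls the
  intervals to the left.
\<close>

lemma AE_has_vector_derivative_indefinite_integral:
  fixes f x :: "real \<Rightarrow> 'b::euclidean_space"
  assumes f: "\<And>t. 0 \<le> t \<Longrightarrow> f integrable_on {0..t}"
    and x: "\<And>t. 0 \<le> t \<Longrightarrow> x t = x 0 + integral {0..t} f"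
  shows "AE t in lborel. 0 \<le> t \<longrightarrow> (x has_vector_derivative f t) (at t within {0..})"
proof -
  \<comment> \<open>extended by zero, \<open>f\<close> is integrable on every interval and can be reflected\<close>
  define F where "F s = (if s \<in> {0..} then f s else 0)" for s
  have F: "F integrable_on {a..b}" for a b
  proof -
    have "{0..} \<inter> {a..b} = {max 0 a..b}" by auto
    moreover have "f integrable_on {max 0 a..b}"
      using integrable_on_subinterval[OF f[of "max 0 b"], of "max 0 a" b]
      by (cases "0 \<le> b") auto
    ultimately show ?thesis unfolding F_def by (simp only: integrable_restrict_Int)
  qed
  obtain N1 where N1: "negligible N1" "\<And>t e. t \<notin> N1 \<Longrightarrow> 0 < e \<Longrightarrow> \<exists>d>0. \<forall>h. 0 < h \<and> h < d \<longrightarrow>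
      norm (integral {t..t + h} F /\<^sub>R h - F t) < e"
    using forward_averages_tendsto_AE[of F] F by blast
  have F': "(\<lambda>s. F (- s)) integrable_on {a..b}" for a b
  proof -
    have "(\<lambda>s. F (- s)) integrable_on {- (- a)..- (- b)}"
      by (rule iffD2[OF Henstock_Kurzweil_Integration.integrable_reflect_real F])
    then show ?thesis by simp
  qed
  obtain N2 where N2: "negligible N2" "\<And>t e. \<lbrakk>t \<notin> N2; 0 < e\<rbrakk> \<Longrightarrow> \<exists>d>0. \<forall>h. 0 < h \<and> h < d \<longrightarrow>
      norm (integral {t..t + h} (\<lambda>s. F (- s)) /\<^sub>R h - F (- t)) < e"
    using forward_averages_tendsto_AE[of "\<lambda>s. F (- s)"] F' by blast
  have neg: "negligible (N1 \<union> uminus ` N2 \<union> {0})"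
    using N1(1) negligible_differentiable_image_negligible[OF _ N2(1), of uminus]
    by (auto intro!: negligible_Un derivative_intros simp: differentiable_on_def)
  have incr: "x b - x a = integral {a..b} F" if "0 \<le> a" "a \<le> b" for a b
  proof -
    have "integral {a..b} F = integral {a..b} f"
      by (rule integral_cong) (use that in \<open>auto simp: F_def\<close>)
    moreover have "integral {0..a} f + integral {a..b} f = integral {0..b} f"
      using that f[of b] by (intro Henstock_Kurzweil_Integration.integral_combine) auto
    moreover have "x b = x 0 + integral {0..b} f" "x a = x 0 + integral {0..a} f"
      using that by (auto intro!: x)
    ultimately show ?thesis by (simp add: algebra_simps)
  qed
  have "(x has_vector_derivative f t) (at t within {0..})"
    if t: "0 \<le> t" "t \<notin> N1 \<union> uminus ` N2 \<union> {0}" for t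
  proof -
    have Ft: "F t = f t" using t by (simp add: F_def)
    have t': "t \<notin> N1" "- t \<notin> N2" "0 < t" using t by (auto simp: image_iff)
    have "\<exists>d>0. \<forall>s\<in>{0..}. norm (s - t) < d \<longrightarrow> norm (x s - x t - (s - t) *\<^sub>R f t) \<le> e * norm (s - t)"
      if e: "0 < e" for e
    proof -
      obtain d1 where d1: "d1 > 0" "\<And>h. \<lbrakk>0 < h; h < d1\<rbrakk> \<Longrightarrow>
          norm (integral {t..t + h} F /\<^sub>R h - f t) < e"
        using N1(2)[OF t'(1) e] Ft by auto
      obtain d2 where d2: "d2 > 0" "\<And>h. \<lbrakk>0 < h; h < d2\<rbrakk> \<Longrightarrow>
          norm (integral {- t..- t + h} (\<lambda>s. F (- s)) /\<^sub>R h - f t) < e"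
        using N2(2)[OF t'(2) e] Ft by auto
      have scale: "norm (I - h *\<^sub>R f t) \<le> e * h" if "0 < h" "norm (I /\<^sub>R h - f t) < e" for I h
      proof -
        have "I - h *\<^sub>R f t = h *\<^sub>R (I /\<^sub>R h - f t)"
          using that(1) by (simp add: scaleR_diff_right)
        then have "norm (I - h *\<^sub>R f t) = h * norm (I /\<^sub>R h - f t)"
          using that(1) by simp
        then show ?thesis using that by (simp add: mult.commute)
      qed
      have "norm (x s - x t - (s - t) *\<^sub>R f t) \<le> e * norm (s - t)"
        if s: "0 \<le> s" "norm (s - t) < min d1 d2" for s
      proof (cases s t rule: linorder_cases)
        case greater
        then show ?thesis
          using scale[OF _ d1(2)[of "s - t"]] s t incr[of t s] by auto
      next
        case less
        have "x t - x s = integral {- t..- t + (t - s)} (\<lambda>s. F (- s))"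
          using incr[of s t] less s integral_reflect_real[where f = F and a = s and b = t] by simp
        then have "norm (x t - x s - (t - s) *\<^sub>R f t) \<le> e * (t - s)"
          using scale[OF _ d2(2)[of "t - s"]] s less by auto
        moreover have "x s - x t - (s - t) *\<^sub>R f t = - (x t - x s - (t - s) *\<^sub>R f t)"
          by (simp add: algebra_simps)
        ultimately show ?thesis using less by (metis abs_minus_commute abs_of_pos diff_gt_0_iff_gt norm_minus_cancel real_norm_def)
      qed simp
      then show ?thesis using d1(1) d2(1) by (intro exI[of _ "min d1 d2"]) auto
    qed
    then show ?thesis
      unfolding has_vector_derivative_def has_derivative_within_alt
      by (auto intro: bounded_linear_scaleR_left)
  qed
  then have "AE t in lebesgue. 0 \<le> t \<longrightarrow> (x has_vector_derivative f t) (at t within {0..})"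
    using neg by (intro AE_I'[of "N1 \<union> uminus ` N2 \<union> {0}"]) (auto simp: negligible_iff_null_sets)
  then show ?thesis by (simp add: AE_completion_iff)
qed

lemma has_vector_derivative_indefinite_integral_at:
  fixes f x :: "real \<Rightarrow> 'b::banach"
  assumes f: "\<And>t. 0 \<le> t \<Longrightarrow> f integrable_on {0..t}"
    and x: "\<And>t. 0 \<le> t \<Longrightarrow> x t = x 0 + integral {0..t} f"
    and t: "0 \<le> t" and cont: "continuous (at t within {0..}) f"
  shows "(x has_vector_derivative f t) (at t within {0..})"
proof -
  have "((\<lambda>u. integral {0..u} f) has_vector_derivative f t) (at t within ({0..t + 1} - {}))"
    using t cont by (intro integral_has_vector_derivative_continuous_at f) (auto intro: continuous_within_subset)
  then have "((\<lambda>u. x 0 + integral {0..u} f) has_vector_derivative 0 + f t) (at t within {0..t + 1})"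
    by (intro has_vector_derivative_add has_vector_derivative_const) simp
  then have "(x has_vector_derivative 0 + f t) (at t within {0..t + 1})"
  proof (rule has_vector_derivative_transform[rotated 2])
    show "t \<in> {0..t + 1}" using t by simp
    show "x s = x 0 + integral {0..s} f" if "s \<in> {0..t + 1}" for s
      by (rule x) (use that in simp)
  qed
  moreover have "at t within {0..t + 1} = at t within {0..}"
    by (rule at_within_nhd[of t "{..<t + 1}"]) auto
  ultimately show ?thesis by simp
qed

section \<open>The Riccati equation preserves invertibility\<close>

text \<open>
  For \<open>P = S\<^sup>-\<^sup>1\<close> the Riccati equation reads \<open>P' = - P A - A\<^sup>T P - P \<sigma> \<sigma>\<^sup>T P + C\<^sup>T C\<close>. The quadratic term
  \<open>P \<sigma> \<sigma>\<^sup>T P\<close> has nonnegative trace and enters with the good sign, so the derivative of the trace of \<open>P\<close>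
  is at most affine in that trace. The two sums are the entrywise norm of \<open>A\<close>, once for \<open>A\<close> and once for
  its transpose.
\<close>

lemma riccati_trace_matrix_inv_le:
  fixes A S :: "real^'d^'d" and C :: "real^'d^'m" and \<sigma> :: "real^'p^'d"
  assumes "psd S" "invertible S"
  shows "- trace (matrix_inv S ** riccati A C \<sigma> S ** matrix_inv S) \<le>
    ((\<Sum>i\<in>UNIV. \<Sum>k\<in>UNIV. \<bar>A $ k $ i\<bar>) + (\<Sum>i\<in>UNIV. \<Sum>k\<in>UNIV. \<bar>A $ i $ k\<bar>)) * trace (matrix_inv S)
      + trace (transpose C ** C)"
proof -
  let ?P = "matrix_inv S"
  note i = matrix_inv_inverse[OF assms(2)]
  have P: "psd ?P" by (rule psd_matrix_inv[OF assms])
  then have sym: "transpose ?P = ?P" by (simp add: psd_def)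
  have 1: "?P ** (A ** S) ** ?P = ?P ** A"
    by (simp add: i flip: matrix_mul_assoc)
  have 2: "?P ** (S ** transpose A) ** ?P = transpose A ** ?P"
    by (simp add: i matrix_mul_assoc)
  have 3: "?P ** (\<sigma> ** transpose \<sigma>) ** ?P = (?P ** \<sigma>) ** transpose (?P ** \<sigma>)"
    by (simp add: matrix_transpose_mul sym matrix_mul_assoc)
  have 4: "?P ** (S ** transpose C ** C ** S) ** ?P = transpose C ** C"
  proof -
    have "?P ** (S ** transpose C ** C ** S) ** ?P = (?P ** S) ** transpose C ** C ** (S ** ?P)"
      by (simp only: matrix_mul_assoc)
    then show ?thesis by (simp add: i)
  qed
  have "?P ** riccati A C \<sigma> S ** ?P =
      ?P ** A + transpose A ** ?P + (?P ** \<sigma>) ** transpose (?P ** \<sigma>) - transpose C ** C"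
    unfolding riccati_def matrix_diff_ldistrib matrix_diff_rdistrib matrix_add_ldistrib matrix_add_rdistrib
      1 2 3 4 ..
  then have "- trace (?P ** riccati A C \<sigma> S ** ?P) =
      - trace (?P ** A) - trace (?P ** transpose A) - trace ((?P ** \<sigma>) ** transpose (?P ** \<sigma>))
      + trace (transpose C ** C)"
    by (simp add: trace_add trace_sub trace_mul_sym[of "transpose A"])
  then show ?thesis
    using abs_trace_psd_mult_le[OF P, of A] abs_trace_psd_mult_le[OF P, of "transpose A"]
      trace_mult_transpose_nonneg[of "?P ** \<sigma>"]
    by (simp add: transpose_def distrib_right)
qed

lemma abs_psd_bilinear_le:
  fixes P :: "real^'n^'n"
  assumes "psd P"
  shows "\<bar>v \<bullet> (P *v w)\<bar> \<le> trace P * ((\<Sum>i\<in>UNIV. \<bar>v $ i\<bar>) * (\<Sum>j\<in>UNIV. \<bar>w $ j\<bar>))"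
proof -
  have "\<bar>v \<bullet> (P *v w)\<bar> = \<bar>\<Sum>i\<in>UNIV. \<Sum>j\<in>UNIV. v $ i * (P $ i $ j * w $ j)\<bar>"
    by (simp add: inner_vec_def matrix_vector_mult_def sum_distrib_left)
  also have "\<dots> \<le> (\<Sum>i\<in>UNIV. \<Sum>j\<in>UNIV. \<bar>v $ i * (P $ i $ j * w $ j)\<bar>)"
    by (intro order_trans[OF sum_abs] sum_mono order_refl)
  also have "\<dots> \<le> (\<Sum>i\<in>UNIV. \<Sum>j\<in>UNIV. trace P * (\<bar>v $ i\<bar> * \<bar>w $ j\<bar>))"
  proof (intro sum_mono)
    fix i j
    have "\<bar>P $ i $ j\<bar> * (\<bar>v $ i\<bar> * \<bar>w $ j\<bar>) \<le> trace P * (\<bar>v $ i\<bar> * \<bar>w $ j\<bar>)"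
      by (intro mult_right_mono psd_component_le_trace assms) auto
    then show "\<bar>v $ i * (P $ i $ j * w $ j)\<bar> \<le> trace P * (\<bar>v $ i\<bar> * \<bar>w $ j\<bar>)"
      by (simp add: abs_mult mult_ac)
  qed
  also have "\<dots> = trace P * ((\<Sum>i\<in>UNIV. \<bar>v $ i\<bar>) * (\<Sum>j\<in>UNIV. \<bar>w $ j\<bar>))"
    by (subst sum_product) (simp only: sum_distrib_left)
  finally show ?thesis .
qed

text \<open>
  A Gronwall inequality. As \<open>u\<close> is nonnegative, \<open>c u + k \<le> (c + k) (u + 1)\<close>, so
  \<open>(u + 1) exp (- (c + k) s)\<close> is nonincreasing.
\<close>

lemma linear_growth_bound:
  fixes u u' :: "real \<Rightarrow> real"
  assumes "a \<le> b"
    and u: "\<And>s. s \<in> {a..b} \<Longrightarrow> (u has_real_derivative u' s) (at s within {a..b})"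
    and le: "\<And>s. s \<in> {a..b} \<Longrightarrow> u' s \<le> c * u s + k"
    and nonneg: "\<And>s. s \<in> {a..b} \<Longrightarrow> 0 \<le> u s" and ck: "0 \<le> c" "0 \<le> k"
  shows "u b \<le> (u a + 1) * exp ((c + k) * (b - a))"
proof -
  define w where "w s = (u s + 1) * exp (- (c + k) * s)" for s
  have "w b \<le> w a"
  proof (rule DERIV_nonpos_imp_decreasing_open[OF assms(1)])
    have "continuous_on {a..b} u"
      by (metis DERIV_continuous continuous_on_eq_continuous_within u)
    then show "continuous_on {a..b} w" unfolding w_def by (intro continuous_intros)
    fix s assume s: "a < s" "s < b"
    then have "(u has_real_derivative u' s) (at s)"
      using u[of s] by (simp add: at_within_Icc_at)
    then have "(w has_real_derivative (u' s - (c + k) * (u s + 1)) * exp (- (c + k) * s)) (at s)"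
      unfolding w_def by (auto intro!: derivative_eq_intros simp: algebra_simps)
    moreover have "u' s - (c + k) * (u s + 1) \<le> 0"
    proof -
      have "u' s \<le> c * u s + k" "0 \<le> k * u s" using le[of s] nonneg[of s] ck s by auto
      then show ?thesis using ck by (simp add: algebra_simps)
    qed
    ultimately show "\<exists>y. (w has_real_derivative y) (at s) \<and> y \<le> 0"
      by (intro exI conjI) (auto intro: mult_nonpos_nonneg)
  qed
  then have "u b + 1 \<le> (u a + 1) * exp ((c + k) * (b - a))"
    unfolding w_def by (simp add: exp_minus exp_diff field_simps exp_add)
  then show ?thesis by simp
qed

text \<open>
  The Gronwall bound keeps the trace of \<open>S\<^sup>-\<^sup>1\<close>, and hence every entry of \<open>S\<^sup>-\<^sup>1\<close>, bounded up to time \<open>T\<close>.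
  If \<open>S T\<close> had a kernel vector \<open>x\<close>, then \<open>x \<bullet> x = x \<bullet> S\<^sup>-\<^sup>1 (S x)\<close> would tend to \<open>0\<close> from the left of \<open>T\<close>.
\<close>

lemma riccati_solution_stays_invertible:
  fixes S :: "real \<Rightarrow> real^'d^'d" and A :: "real^'d^'d" and C :: "real^'d^'m" and \<sigma> :: "real^'p^'d"
  assumes T: "0 < T" and cont: "continuous_on {0..T} S"
    and psd: "\<And>t. t \<in> {0..T} \<Longrightarrow> psd (S t)"
    and inv: "\<And>t. t \<in> {0..<T} \<Longrightarrow> invertible (S t)"
    and deriv: "\<And>t. t \<in> {0..<T} \<Longrightarrow>
      (S has_vector_derivative riccati A C \<sigma> (S t)) (at t within {0..T})"
  shows "invertible (S T)"
proof -
  define u where "u t = trace (matrix_inv (S t))" for t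
  define c where "c = (\<Sum>i\<in>UNIV. \<Sum>k\<in>UNIV. \<bar>A $ k $ i\<bar>) + (\<Sum>i\<in>UNIV. \<Sum>k\<in>UNIV. \<bar>A $ i $ k\<bar>)"
  define k where "k = trace (transpose C ** C)"
  define K where "K = (u 0 + 1) * exp ((c + k) * T)"
  have c: "0 \<le> c" unfolding c_def by (intro add_nonneg_nonneg sum_nonneg) auto
  have k: "0 \<le> k" using trace_mult_transpose_nonneg[of "transpose C"] by (simp add: k_def)
  have P: "psd (matrix_inv (S t))" if "t \<in> {0..<T}" for t
    using that by (intro psd_matrix_inv psd inv) auto
  have u_nonneg: "0 \<le> u t" if "t \<in> {0..<T}" for t
    using psd_trace_nonneg[OF P[OF that]] by (simp add: u_def)
  have u_bound: "u t \<le> K" if t: "t \<in> {0..<T}" for t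
  proof -
    have "u t \<le> (u 0 + 1) * exp ((c + k) * (t - 0))"
    proof (rule linear_growth_bound[where u' = "\<lambda>s. - trace (matrix_inv (S s) ** riccati A C \<sigma> (S s) ** matrix_inv (S s))"])
      fix s assume s: "s \<in> {0..t}"
      then have s': "s \<in> {0..<T}" using t by auto
      have "(S has_vector_derivative riccati A C \<sigma> (S s)) (at s within {0..t})"
        using has_vector_derivative_within_subset[OF deriv[OF s']] t by auto
      then show "(u has_real_derivative - trace (matrix_inv (S s) ** riccati A C \<sigma> (S s) ** matrix_inv (S s))) (at s within {0..t})"
        unfolding u_def using inv[OF s'] by (rule DERIV_trace_matrix_inv)
      show "- trace (matrix_inv (S s) ** riccati A C \<sigma> (S s) ** matrix_inv (S s)) \<le> c * u s + k"
        unfolding c_def k_def u_def using s' by (intro riccati_trace_matrix_inv_le psd inv) auto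
      show "0 \<le> u s" by (rule u_nonneg[OF s'])
    qed (use t c k in auto)
    also have "\<dots> \<le> K"
      unfolding K_def using t c k u_nonneg[of 0] T by (intro mult_left_mono) (auto intro!: mult_left_mono)
    finally show ?thesis .
  qed
  have "x = 0" if x: "S T *v x = 0" for x
  proof -
    let ?h = "\<lambda>t. K * ((\<Sum>i\<in>UNIV. \<bar>x $ i\<bar>) * (\<Sum>j\<in>UNIV. \<bar>(S t *v x) $ j\<bar>))"
    have "(S \<longlongrightarrow> S T) (at_left T)"
      using cont T by (auto simp: continuous_on_def at_within_Icc_at_left dest!: bspec[of _ _ T])
    then have "(?h \<longlongrightarrow> K * ((\<Sum>i\<in>UNIV. \<bar>x $ i\<bar>) * (\<Sum>j\<in>UNIV. \<bar>(S T *v x) $ j\<bar>))) (at_left T)"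
      by (intro tendsto_intros tendsto_matrix_vector_mult)
    then have lim: "(?h \<longlongrightarrow> 0) (at_left T)" by (simp add: x)
    have "\<forall>\<^sub>F t in at_left T. t \<in> {0<..<T}"
      by (rule eventually_at_leftI[OF _ T]) simp
    then have "\<forall>\<^sub>F t in at_left T. x \<bullet> x \<le> ?h t"
    proof eventually_elim
      case (elim t)
      then have t: "t \<in> {0..<T}" by auto
      have "x \<bullet> x = x \<bullet> (matrix_inv (S t) *v (S t *v x))"
        by (simp add: matrix_vector_mul_assoc matrix_inv_inverse inv[OF t])
      also have "\<dots> \<le> u t * ((\<Sum>i\<in>UNIV. \<bar>x $ i\<bar>) * (\<Sum>j\<in>UNIV. \<bar>(S t *v x) $ j\<bar>))"
        unfolding u_def using abs_psd_bilinear_le[OF P[OF t], of x "S t *v x"] by linarith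
      also have "\<dots> \<le> ?h t"
        by (intro mult_right_mono u_bound[OF t] mult_nonneg_nonneg sum_nonneg) auto
      finally show ?case .
    qed
    then have "x \<bullet> x \<le> 0" by (intro tendsto_lowerbound[OF lim]) auto
    then show ?thesis by (metis inner_eq_zero_iff inner_ge_zero order_antisym)
  qed
  then show ?thesis
    by (simp add: invertible_left_inverse matrix_left_invertible_ker)
qed

section \<open>Algebra of the flow matrix\<close>

lemma covariance_flow_component:
  fixes G :: "real^'d^'d" and x :: "'i \<Rightarrow> real^'d" and c :: real and I :: "'i set"
  defines "S \<equiv> c *\<^sub>R (\<Sum>i\<in>I. outer (x i) (x i))"
  shows "c * (\<Sum>i\<in>I. x i $ a * (G *v x i) $ b + (G *v x i) $ a * x i $ b) =
    (G ** S + S ** transpose G) $ a $ b"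
proof -
  have "(G ** S) $ a $ b = c * (\<Sum>i\<in>I. (G *v x i) $ a * x i $ b)"
    unfolding S_def
    by (simp add: matrix_matrix_mult_def matrix_vector_mult_def outer_def sum_distrib_left
        sum_distrib_right mult_ac) (rule sum.swap)
  moreover have "(S ** transpose G) $ a $ b = c * (\<Sum>i\<in>I. x i $ a * (G *v x i) $ b)"
    unfolding S_def
    by (simp add: matrix_matrix_mult_def matrix_vector_mult_def outer_def transpose_def sum_distrib_left
        sum_distrib_right mult_ac) (rule sum.swap)
  ultimately show ?thesis by (simp add: sum.distrib distrib_left)
qed

text \<open>
  The design of the flow matrix: half of each of the noise and correction terms comes from
  \<open>G S\<close> and half from its transpose \<open>S G\<^sup>T\<close>, while the skew term cancels against its own transpose.
\<close>

lemma flow_matrix_lyapunov: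
  fixes A S R :: "real^'d^'d" and C :: "real^'d^'m" and \<sigma> :: "real^'p^'d"
  assumes inv: "invertible S" and sym: "transpose S = S" and R: "skew R"
  shows "flow_matrix A C \<sigma> S R ** S + S ** transpose (flow_matrix A C \<sigma> S R) = riccati A C \<sigma> S"
proof -
  let ?H = "S ** transpose C ** C ** S" and ?Q = "\<sigma> ** transpose \<sigma>"
  have c: "M ** matrix_inv S ** S = M" for M :: "real^'d^'d"
    using matrix_inv_inverse[OF inv] by (simp flip: matrix_mul_assoc)
  have GS: "flow_matrix A C \<sigma> S R ** S = A ** S - (1/2) *\<^sub>R ?H + (1/2) *\<^sub>R ?Q + R"
    unfolding flow_matrix_def gain_def
    by (simp add: matrix_diff_rdistrib matrix_add_rdistrib matrix_scaleR_rdistrib c)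
  have tr: "transpose (M - (1/2) *\<^sub>R H + (1/2) *\<^sub>R Q + R) =
      transpose M - (1/2) *\<^sub>R transpose H + (1/2) *\<^sub>R transpose Q + transpose R" for M H Q R :: "real^'d^'d"
    by (simp add: transpose_def vec_eq_iff)
  have "S ** transpose (flow_matrix A C \<sigma> S R) = transpose (flow_matrix A C \<sigma> S R ** S)"
    by (simp add: matrix_transpose_mul sym)
  also have "\<dots> = S ** transpose A - (1/2) *\<^sub>R ?H + (1/2) *\<^sub>R ?Q - R"
    unfolding GS tr using R by (simp add: matrix_transpose_mul sym skew_def matrix_mul_assoc)
  finally have "S ** transpose (flow_matrix A C \<sigma> S R) = S ** transpose A - (1/2) *\<^sub>R ?H + (1/2) *\<^sub>R ?Q - R" .
  then show ?thesis
    unfolding GS riccati_def by (simp add: vec_eq_iff)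
qed

section \<open>The deviation flow along one path\<close>

lemma continuous_on_atLeast_iff_Icc:
  fixes f :: "real \<Rightarrow> 'a::topological_space"
  shows "continuous_on {a..} f \<longleftrightarrow> (\<forall>T. continuous_on {a..T} f)"
proof safe
  assume c: "\<forall>T. continuous_on {a..T} f"
  show "continuous_on {a..} f"
    unfolding continuous_on_eq_continuous_within
  proof
    fix t assume t: "t \<in> {a..}"
    have "at t within {a..t + 1} = at t within {a..}"
      by (rule at_within_nhd[of t "{..<t + 1}"]) auto
    moreover have "continuous (at t within {a..t + 1}) f"
      using c t by (auto simp: continuous_on_eq_continuous_within)
    ultimately show "continuous (at t within {a..}) f" by simp
  qed
qed (auto intro: continuous_on_subset)

lemma outer_component: "outer v w $ a $ b = v $ a * w $ b"
  by (simp add: outer_def)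

lemma psd_sum_outer:
  fixes x :: "'i \<Rightarrow> real^'d"
  assumes "0 \<le> c"
  shows "psd (c *\<^sub>R (\<Sum>i\<in>I. outer (x i) (x i)))"
proof -
  have q: "v \<bullet> (outer w w *v v) = (v \<bullet> w)\<^sup>2" for v w :: "real^'d"
    by (simp add: inner_vec_def matrix_vector_mult_def outer_def power2_eq_square sum_product
        sum_distrib_left mult_ac)
  have "v \<bullet> ((c *\<^sub>R (\<Sum>i\<in>I. outer (x i) (x i))) *v v) = c * (\<Sum>i\<in>I. v \<bullet> (outer (x i) (x i) *v v))" for v
  proof (induction I rule: infinite_finite_induct)
    case (insert i I)
    then show ?case
      by (simp add: scaleR_add_right matrix_vector_mult_add_rdistrib inner_add_right distrib_left
          flip: scaleR_matrix_vector_assoc)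
  qed auto
  then have "0 \<le> v \<bullet> ((c *\<^sub>R (\<Sum>i\<in>I. outer (x i) (x i))) *v v)" for v
    using assms by (simp add: q sum_nonneg)
  moreover have "transpose (c *\<^sub>R (\<Sum>i\<in>I. outer (x i) (x i))) = c *\<^sub>R (\<Sum>i\<in>I. outer (x i) (x i))"
    by (simp add: transpose_def outer_def vec_eq_iff mult_ac)
  ultimately show ?thesis by (simp add: psd_def)
qed

text \<open>
  The situation of the particle deviations for one fixed outcome. The flow equation is required in
  integrated form, because the skew matrices \<open>R\<close> may be arbitrarily irregular in time. Only the
  initial covariance is assumed invertible; at a singular \<open>S s\<close> the term \<open>matrix_inv (S s)\<close> in the
  flow matrix is an unspecified matrix, so the equation says nothing useful there before
  invertibility at all times has been proved.
\<close>

locale deviation_flow =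
  fixes A :: "real^'d^'d" and C :: "real^'d^'m" and \<sigma> :: "real^'p^'d"
    and I :: "'i set" and c :: real and \<xi> :: "'i \<Rightarrow> real \<Rightarrow> real^'d"
    and S :: "real \<Rightarrow> real^'d^'d" and R :: "real \<Rightarrow> real^'d^'d"
  assumes finite_I: "finite I" and c_nonneg: "0 \<le> c"
    and S_eq: "\<And>t. S t = c *\<^sub>R (\<Sum>i\<in>I. outer (\<xi> i t) (\<xi> i t))"
    and skew: "\<And>t. 0 \<le> t \<Longrightarrow> skew (R t)"
    and flow_integrable: "\<And>i t. i \<in> I \<Longrightarrow> 0 \<le> t \<Longrightarrow>
      (\<lambda>s. flow_matrix A C \<sigma> (S s) (R s) *v \<xi> i s) absolutely_integrable_on {0..t}"
    and flow: "\<And>i t. i \<in> I \<Longrightarrow> 0 \<le> t \<Longrightarrow>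
      \<xi> i t = \<xi> i 0 + integral {0..t} (\<lambda>s. flow_matrix A C \<sigma> (S s) (R s) *v \<xi> i s)"
    and init: "invertible (S 0)"
begin

abbreviation g where "g i s \<equiv> flow_matrix A C \<sigma> (S s) (R s) *v \<xi> i s"

lemma g_integrable: "i \<in> I \<Longrightarrow> 0 \<le> t \<Longrightarrow> g i integrable_on {0..t}"
  using flow_integrable by (auto simp: absolutely_integrable_on_def)

lemma continuous_deviation: "i \<in> I \<Longrightarrow> continuous_on {0..} (\<xi> i)"
  unfolding continuous_on_atLeast_iff_Icc
proof
  fix T assume i: "i \<in> I"
  show "continuous_on {0..T} (\<xi> i)"
  proof (cases "0 \<le> T")
    case True
    have "continuous_on {0..T} (\<lambda>t. \<xi> i 0 + integral {0..t} (g i))"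
      by (intro continuous_intros indefinite_integral_continuous_1 g_integrable i True)
    moreover have "\<xi> i t = \<xi> i 0 + integral {0..t} (g i)" if "t \<in> {0..T}" for t
      using that by (intro flow i) auto
    ultimately show ?thesis by (subst continuous_on_cong[OF refl]) 
  qed simp
qed

lemma continuous_covariance: "continuous_on {0..} S"
  unfolding continuous_on_def S_eq
proof
  fix t :: real assume t: "t \<in> {0..}"
  have "(\<xi> i \<longlongrightarrow> \<xi> i t) (at t within {0..})" if "i \<in> I" for i
    using continuous_deviation[OF that] t by (simp add: continuous_on_def)
  then show "((\<lambda>t. c *\<^sub>R (\<Sum>i\<in>I. outer (\<xi> i t) (\<xi> i t))) \<longlongrightarrow> c *\<^sub>R (\<Sum>i\<in>I. outer (\<xi> i t) (\<xi> i t)))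
      (at t within {0..})"
    by (intro tendsto_scaleR tendsto_const tendsto_sum tendsto_outer)
qed

lemma psd_covariance: "psd (S t)"
  unfolding S_eq by (rule psd_sum_outer[OF c_nonneg])

lemma continuous_riccati: "continuous_on {0..} (\<lambda>t. riccati A C \<sigma> (S t))"
  using continuous_covariance unfolding continuous_on_def riccati_def
  by (auto intro!: tendsto_add tendsto_diff tendsto_matrix_mult tendsto_const)

text \<open>
  The product rule turns the flow into \<open>S' = G S + S G\<^sup>T\<close> in integrated form, and the right-hand side
  is the Riccati field at every time where \<open>S\<close> is invertible; the irregular skew part has
  disappeared.
\<close>

lemma covariance_component_increment:
  assumes T: "0 \<le> T" and inv: "\<And>s. s \<in> {0..T} \<Longrightarrow> invertible (S s)"
  shows "((\<lambda>s. riccati A C \<sigma> (S s) $ a $ b) has_integral S T $ a $ b - S 0 $ a $ b) {0..T}"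
proof -
  have comp: "(\<lambda>s. g i s $ k) absolutely_integrable_on {0..T}" if "i \<in> I" for i k
    using absolutely_integrable_linear[OF flow_integrable[OF that T] bounded_linear_vec_nth] by (simp add: o_def)
  have comp_eq: "\<xi> i t $ k = \<xi> i 0 $ k + integral {0..t} (\<lambda>s. g i s $ k)"
    if "i \<in> I" "t \<in> {0..T}" for i k t
  proof -
    have e: "\<xi> i t = \<xi> i 0 + integral {0..t} (g i)" by (rule flow) (use that in auto)
    have "integral {0..t} (\<lambda>s. g i s $ k) = integral {0..t} (g i) $ k"
      using integral_linear[OF g_integrable[of i t] bounded_linear_vec_nth, of k] that by (simp add: o_def)
    then show ?thesis using arg_cong[OF e, of "\<lambda>v. v $ k"] by (simp only: vector_add_component)
  qed
  have sum_int: "((\<lambda>s. c * (\<Sum>i\<in>I. \<xi> i s $ a * g i s $ b + g i s $ a * \<xi> i s $ b)) has_integral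
      c * (\<Sum>i\<in>I. \<xi> i T $ a * \<xi> i T $ b - \<xi> i 0 $ a * \<xi> i 0 $ b)) {0..T}"
    by (intro has_integral_mult_right has_integral_sum finite_I
        has_integral_product_of_indefinite_integrals T comp comp_eq)
  have incr: "c * (\<Sum>i\<in>I. \<xi> i T $ a * \<xi> i T $ b - \<xi> i 0 $ a * \<xi> i 0 $ b) = S T $ a $ b - S 0 $ a $ b"
    by (simp add: S_eq outer_component sum_subtractf right_diff_distrib)
  have integrand: "c * (\<Sum>i\<in>I. \<xi> i s $ a * g i s $ b + g i s $ a * \<xi> i s $ b) = riccati A C \<sigma> (S s) $ a $ b"
    if s: "s \<in> {0..T}" for s
  proof -
    have "c * (\<Sum>i\<in>I. \<xi> i s $ a * g i s $ b + g i s $ a * \<xi> i s $ b) =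
        (flow_matrix A C \<sigma> (S s) (R s) ** S s + S s ** transpose (flow_matrix A C \<sigma> (S s) (R s))) $ a $ b"
      by (subst (3 4) S_eq) (rule covariance_flow_component)
    also have "\<dots> = riccati A C \<sigma> (S s) $ a $ b"
      using s psd_covariance[of s] by (subst flow_matrix_lyapunov) (auto intro: inv skew simp: psd_def)
    finally show ?thesis .
  qed
  show ?thesis by (rule has_integral_eq[OF integrand sum_int[unfolded incr]])
qed

text \<open>
  The integrand of the increments of \<open>S\<close> is the Riccati field along the continuous function \<open>S\<close>, hence
  continuous; the integrated equation therefore upgrades to a classical derivative at every time.
\<close>

lemma covariance_derivative_while_invertible:
  assumes t: "0 \<le> t" "t < T" and inv: "\<And>s. s \<in> {0..<T} \<Longrightarrow> invertible (S s)"
  shows "(S has_vector_derivative riccati A C \<sigma> (S t)) (at t within {0..})"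
proof -
  let ?r = "\<lambda>s. riccati A C \<sigma> (S s)"
  obtain T' where T': "t < T'" "T' < T" using dense[OF t(2)] by blast
  have cont: "continuous_on {0..T'} ?r" by (rule continuous_on_subset[OF continuous_riccati]) auto
  have S_int: "S u = S 0 + integral {0..u} ?r" if u: "u \<in> {0..T'}" for u
  proof -
    have int: "?r integrable_on {0..u}"
      using u by (intro integrable_continuous_real continuous_on_subset[OF cont]) auto
    have "S u $ a $ b - S 0 $ a $ b = integral {0..u} ?r $ a $ b" for a b
    proof -
      have "integral {0..u} ?r $ a $ b = integral {0..u} (\<lambda>s. ?r s $ a $ b)"
        using integral_linear[OF int bounded_linear_compose[OF bounded_linear_vec_nth bounded_linear_vec_nth], of a b]
        by (simp add: o_def)
      then show ?thesis
        using integral_unique[OF covariance_component_increment[of u a b]] u T' inv by simp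
    qed
    then show ?thesis by (simp add: vec_eq_iff algebra_simps)
  qed
  have "((\<lambda>u. S 0 + integral {0..u} ?r) has_vector_derivative 0 + ?r t) (at t within {0..T'})"
    using t T' by (intro has_vector_derivative_add has_vector_derivative_const integral_has_vector_derivative cont) auto
  then have "(S has_vector_derivative 0 + ?r t) (at t within {0..T'})"
  proof (rule has_vector_derivative_transform[rotated 2])
    show "t \<in> {0..T'}" using t T' by simp
    show "S u = S 0 + integral {0..u} ?r" if "u \<in> {0..T'}" for u by (rule S_int[OF that])
  qed
  moreover have "at t within {0..T'} = at t within {0..}"
    by (rule at_within_nhd[of t "{..<T'}"]) (use T' in auto)
  ultimately show ?thesis by simp
qed

text \<open>
  The zeros of \<open>det S\<close> form a closed set, so a singular time would imply a first one, \<open>T > 0\<close>. Before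
  \<open>T\<close> the Riccati equation holds, and its solutions cannot become singular.
\<close>

lemma covariance_invertible:
  assumes "0 \<le> t"
  shows "invertible (S t)"
proof (rule ccontr)
  assume t: "\<not> invertible (S t)"
  define Z where "Z = {0..} \<inter> (\<lambda>s. det (S s)) -` {0}"
  have "continuous_on {0..} (\<lambda>s. det (S s))"
    using continuous_covariance by (auto simp: continuous_on_def intro: tendsto_det)
  then have "closed Z"
    unfolding Z_def by (intro continuous_closed_preimage closed_atLeast closed_singleton)
  moreover have "t \<in> Z" using t assms by (simp add: Z_def invertible_det_nz)
  moreover have bdd: "bdd_below Z" by (auto simp: Z_def intro!: bdd_belowI[of _ 0])
  ultimately have TZ: "Inf Z \<in> Z" by (intro closed_contains_Inf) auto
  define T where "T = Inf Z"
  have sing: "\<not> invertible (S T)" and T0: "0 \<le> T" using TZ by (auto simp: T_def Z_def invertible_det_nz)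
  have inv: "invertible (S s)" if "s \<in> {0..<T}" for s
    using that cInf_lower[OF _ bdd, of s] by (force simp: Z_def T_def invertible_det_nz)
  have "T \<noteq> 0" using sing init by auto
  with T0 have T: "0 < T" by simp
  have "invertible (S T)"
  proof (rule riccati_solution_stays_invertible[OF T _ psd_covariance inv])
    show "continuous_on {0..T} S" by (rule continuous_on_subset[OF continuous_covariance]) auto
    fix s assume "s \<in> {0..<T}"
    then have "(S has_vector_derivative riccati A C \<sigma> (S s)) (at s within {0..})"
      by (intro covariance_derivative_while_invertible[OF _ _ inv]) auto
    then show "(S has_vector_derivative riccati A C \<sigma> (S s)) (at s within {0..T})"
      by (rule has_vector_derivative_within_subset) auto
  qed
  with sing show False by simp
qed

lemma covariance_riccati:
  "0 \<le> t \<Longrightarrow> (S has_vector_derivative riccati A C \<sigma> (S t)) (at t within {0..})"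
  by (rule covariance_derivative_while_invertible[of t "t + 1"]) (auto intro: covariance_invertible)

lemma deviation_derivative_AE:
  assumes "i \<in> I"
  shows "AE t in lborel. 0 \<le> t \<longrightarrow> (\<xi> i has_vector_derivative g i t) (at t within {0..})"
  by (intro AE_has_vector_derivative_indefinite_integral g_integrable flow assms)

lemma deviation_derivative_at:
  assumes i: "i \<in> I" and t: "0 \<le> t" and R: "continuous (at t within {0..}) R"
  shows "(\<xi> i has_vector_derivative g i t) (at t within {0..})"
proof (rule has_vector_derivative_indefinite_integral_at[OF g_integrable[OF i] flow[OF i] t])
  have S: "(S \<longlongrightarrow> S t) (at t within {0..})" and x: "(\<xi> i \<longlongrightarrow> \<xi> i t) (at t within {0..})"
    using continuous_covariance continuous_deviation[OF i] t by (auto simp: continuous_on_def)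
  show "continuous (at t within {0..}) (g i)"
    using R unfolding continuous_within flow_matrix_def gain_def
    by (intro tendsto_matrix_vector_mult tendsto_add tendsto_diff tendsto_matrix_mult tendsto_scaleR
        tendsto_const tendsto_matrix_inv S x covariance_invertible t)
qed

end

section \<open>Uniqueness of the Ito integral\<close>

lemma uniform_partition_exists:
  assumes "0 \<le> t" "0 < d"
  shows "\<exists>n p. partition_upto t n p \<and> (\<forall>k<n. p (Suc k) - p k < d) \<and> (\<forall>k. 0 \<le> p k)"
proof -
  obtain n :: nat where n: "t / d < n" using reals_Archimedean2 by blast
  have n0: "0 < real n" using n assms by (meson divide_nonneg_pos le_less_trans)
  define p where "p k = real k * (t / n)" for k :: nat
  have step: "p (Suc k) - p k = t / n" for k by (simp add: p_def algebra_simps add_divide_distrib)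
  have mesh: "t / n < d" "0 \<le> t / n" using n assms n0 by (auto simp: field_simps)
  have "p k \<le> p (Suc k)" for k using step[of k] mesh(2) by linarith
  moreover have "0 \<le> p k" for k unfolding p_def using mesh(2) by (intro mult_nonneg_nonneg) auto
  moreover have "p 0 = 0" "p n = t" using n0 by (simp_all add: p_def)
  ultimately have "partition_upto t n p \<and> (\<forall>k<n. p (Suc k) - p k < d) \<and> (\<forall>k. 0 \<le> p k)"
    using mesh(1) step by (simp add: partition_upto_def)
  then show ?thesis by blast
qed

lemma borel_measurable_matrix_vector_mult:
  fixes f :: "'w \<Rightarrow> real^'k^'n" and g :: "'w \<Rightarrow> real^'k"
  assumes "f \<in> borel_measurable M" "g \<in> borel_measurable M"
  shows "(\<lambda>x. f x *v g x) \<in> borel_measurable M"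
proof (rule borel_measurable_continuous_Pair[OF assms])
  show "continuous_on UNIV (\<lambda>x :: (real^'k^'n) \<times> (real^'k). fst x *v snd x)"
    unfolding continuous_on_def matrix_vector_mult_def
    by (intro ballI vec_tendstoI) (simp, intro tendsto_intros)
qed

lemma has_ito_integralD:
  assumes "has_ito_integral M F H U J"
  shows "adapted F H" "adapted F U" "\<forall>t\<ge>0. J t \<in> borel_measurable M" "continuous_paths M J"
  using assms unfolding has_ito_integral_def by - (elim conjE, assumption)+

lemma has_ito_integral_sums_converge:
  assumes "has_ito_integral M F H U J" "0 \<le> t" "0 < \<epsilon>" "0 < \<eta>"
  obtains \<delta> where "0 < \<delta>" "\<And>n p. partition_upto t n p \<Longrightarrow> (\<forall>k<n. p (Suc k) - p k < \<delta>) \<Longrightarrow>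
    measure M {\<omega> \<in> space M. norm (ito_sum H U n p \<omega> - J t \<omega>) > \<epsilon>} < \<eta>"
proof -
  have "\<forall>t\<ge>0. \<forall>\<epsilon>>0. \<forall>\<eta>>0. \<exists>\<delta>>0. \<forall>n p.
      partition_upto t n p \<and> (\<forall>k<n. p (Suc k) - p k < \<delta>) \<longrightarrow>
      measure M {\<omega> \<in> space M. norm (ito_sum H U n p \<omega> - J t \<omega>) > \<epsilon>} < \<eta>"
    using assms(1) unfolding has_ito_integral_def by (elim conjE) assumption
  from this[rule_format, OF assms(2-4)] show thesis by (elim exE conjE) (rule that, auto)
qed

text \<open>
  Both processes are limits in probability of the same left-endpoint sums. The union bound, applied
  on one partition fine enough for both, needs the sums to be measurable: the measure of a
  nonmeasurable set is \<open>0\<close> by convention, so it carries no information.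
\<close>

lemma has_ito_integral_unique_at:
  fixes H :: "real \<Rightarrow> 'w \<Rightarrow> real^'k^'n"
  assumes M: "prob_space M" and sub: "\<And>t. subalgebra M (F t)"
    and J: "has_ito_integral M F H U J" and J': "has_ito_integral M F H U J'" and t: "0 \<le> t"
  shows "AE \<omega> in M. J t \<omega> = J' t \<omega>"
proof -
  interpret prob_space M by (rule M)
  have Jm[measurable]: "J t \<in> borel_measurable M" "J' t \<in> borel_measurable M"
    using has_ito_integralD(3)[OF J] has_ito_integralD(3)[OF J'] t by simp_all
  have Hm: "H s \<in> borel_measurable M" if "0 \<le> s" for s
    using has_ito_integralD(1)[OF J] that by (intro measurable_from_subalg[OF sub[of s]]) (simp add: adapted_def)
  have Um: "U s \<in> borel_measurable M" if "0 \<le> s" for s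
    using has_ito_integralD(2)[OF J] that by (intro measurable_from_subalg[OF sub[of s]]) (simp add: adapted_def)
  have small: "prob {\<omega> \<in> space M. norm (J t \<omega> - J' t \<omega>) > 2 * e} = 0" if e: "0 < e" for e
  proof (rule antisym[OF field_le_epsilon measure_nonneg])
    fix \<eta> :: real assume "0 < \<eta>"
    then have h: "0 < \<eta> / 2" by simp
    obtain d where d: "0 < d" "\<And>n p. partition_upto t n p \<Longrightarrow> (\<forall>k<n. p (Suc k) - p k < d) \<Longrightarrow>
        prob {\<omega> \<in> space M. norm (ito_sum H U n p \<omega> - J t \<omega>) > e} < \<eta> / 2"
      by (rule has_ito_integral_sums_converge[OF J t e h]) (rule that, assumption, blast)
    obtain d' where d': "0 < d'" "\<And>n p. partition_upto t n p \<Longrightarrow> (\<forall>k<n. p (Suc k) - p k < d') \<Longrightarrow>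
        prob {\<omega> \<in> space M. norm (ito_sum H U n p \<omega> - J' t \<omega>) > e} < \<eta> / 2"
      by (rule has_ito_integral_sums_converge[OF J' t e h]) (rule that, assumption, blast)
    obtain n p where p: "partition_upto t n p" "\<forall>k<n. p (Suc k) - p k < min d d'" "\<And>k. 0 \<le> p k"
      using uniform_partition_exists[OF t, of "min d d'"] d(1) d'(1) by auto
    have [measurable]: "ito_sum H U n p \<in> borel_measurable M"
      unfolding ito_sum_def[abs_def]
      by (intro borel_measurable_sum borel_measurable_matrix_vector_mult borel_measurable_diff Hm Um p)
    let ?B = "{\<omega> \<in> space M. norm (ito_sum H U n p \<omega> - J t \<omega>) > e}"
    let ?B' = "{\<omega> \<in> space M. norm (ito_sum H U n p \<omega> - J' t \<omega>) > e}"
    have "prob {\<omega> \<in> space M. norm (J t \<omega> - J' t \<omega>) > 2 * e} \<le> prob (?B \<union> ?B')"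
    proof (rule finite_measure_mono)
      show "{\<omega> \<in> space M. norm (J t \<omega> - J' t \<omega>) > 2 * e} \<subseteq> ?B \<union> ?B'"
      proof
        fix \<omega> assume w: "\<omega> \<in> {\<omega> \<in> space M. norm (J t \<omega> - J' t \<omega>) > 2 * e}"
        have "norm (J t \<omega> - J' t \<omega>) \<le> norm (ito_sum H U n p \<omega> - J t \<omega>) + norm (ito_sum H U n p \<omega> - J' t \<omega>)"
          using norm_triangle_ineq4[of "ito_sum H U n p \<omega> - J' t \<omega>" "ito_sum H U n p \<omega> - J t \<omega>"] by simp
        with w show "\<omega> \<in> ?B \<union> ?B'" by auto
      qed
    qed measurable
    also have "\<dots> \<le> prob ?B + prob ?B'"
      by (rule measure_Un_le) measurable
    also have "\<dots> \<le> 0 + \<eta>"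
    proof -
      have "prob ?B < \<eta> / 2" by (rule d(2)[OF p(1)]) (use p(2) in simp)
      moreover have "prob ?B' < \<eta> / 2" by (rule d'(2)[OF p(1)]) (use p(2) in simp)
      ultimately show ?thesis by simp
    qed
    finally show "prob {\<omega> \<in> space M. norm (J t \<omega> - J' t \<omega>) > 2 * e} \<le> 0 + \<eta>" .
  qed
  have "AE \<omega> in M. norm (J t \<omega> - J' t \<omega>) \<le> 2 * (1 / Suc n)" for n
  proof (rule AE_I)
    show "{\<omega> \<in> space M. \<not> norm (J t \<omega> - J' t \<omega>) \<le> 2 * (1 / Suc n)} \<subseteq>
        {\<omega> \<in> space M. norm (J t \<omega> - J' t \<omega>) > 2 * (1 / Suc n)}" by auto
    show "emeasure M {\<omega> \<in> space M. norm (J t \<omega> - J' t \<omega>) > 2 * (1 / Suc n)} = 0"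
      using small[of "1 / Suc n"] by (simp add: emeasure_eq_measure)
  qed measurable
  then have "AE \<omega> in M. \<forall>n. norm (J t \<omega> - J' t \<omega>) \<le> 2 * (1 / Suc n)"
    by (simp add: AE_all_countable)
  then show ?thesis
  proof eventually_elim
    case (elim \<omega>)
    have "(\<lambda>n. 2 * (1 / real (Suc n))) \<longlonglongrightarrow> 2 * 0"
      using LIMSEQ_inverse_real_of_nat by (intro tendsto_mult) (auto simp: inverse_eq_divide)
    then have "norm (J t \<omega> - J' t \<omega>) \<le> 2 * 0"
      using elim by (intro LIMSEQ_le_const[of "\<lambda>n. 2 * (1 / real (Suc n))"]) auto
    then show ?case by simp
  qed
qed

text \<open>
  Versions agree almost surely at each fixed time, hence simultaneously at all nonnegative rational
  times, and path continuity extends the equality to all times \<open>t \<ge> 0\<close>.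
\<close>

lemma has_ito_integral_unique:
  fixes H :: "real \<Rightarrow> 'w \<Rightarrow> real^'k^'n"
  assumes M: "prob_space M" and sub: "\<And>t. subalgebra M (F t)"
    and J: "has_ito_integral M F H U J" and J': "has_ito_integral M F H U J'"
  shows "AE \<omega> in M. \<forall>t\<ge>0. J t \<omega> = J' t \<omega>"
proof -
  have "AE \<omega> in M. \<forall>q\<in>\<rat> \<inter> {0..}. J q \<omega> = J' q \<omega>"
    by (intro AE_ball_countable' has_ito_integral_unique_at[OF M sub J J'])
       (auto intro: countable_subset[OF _ countable_rat])
  moreover have "AE \<omega> in M. continuous_on {0..} (\<lambda>t. J t \<omega>)" "AE \<omega> in M. continuous_on {0..} (\<lambda>t. J' t \<omega>)"
    using has_ito_integralD(4)[OF J] has_ito_integralD(4)[OF J'] by (simp_all add: continuous_paths_def)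
  ultimately show ?thesis
  proof eventually_elim
    case (elim \<omega>)
    show ?case
    proof (intro allI impI)
      fix t :: real assume t: "0 \<le> t"
      have "\<exists>q\<in>\<rat>. t < q \<and> q < t + 1 / Suc n" for n
        by (rule Rats_dense_in_real) simp
      then obtain q where q: "\<And>n. q n \<in> \<rat>" "\<And>n. t < q n" "\<And>n. q n < t + 1 / real (Suc n)"
        by metis
      have "q \<longlonglongrightarrow> t"
      proof (rule tendsto_sandwich[of "\<lambda>_. t" q sequentially "\<lambda>n. t + 1 / real (Suc n)"])
        show "(\<lambda>n. t + 1 / real (Suc n)) \<longlonglongrightarrow> t"
          using LIMSEQ_inverse_real_of_nat_add[of t] by (simp add: inverse_eq_divide)
      qed (use q in \<open>auto intro!: always_eventually less_imp_le\<close>)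
      moreover have "q n \<in> {0..}" for n using q(2)[of n] t by auto
      ultimately have "(\<lambda>n. J (q n) \<omega>) \<longlonglongrightarrow> J t \<omega>" "(\<lambda>n. J' (q n) \<omega>) \<longlonglongrightarrow> J' t \<omega>"
        using elim(2,3) t by (auto intro: continuous_on_tendsto_compose)
      moreover have "J (q n) \<omega> = J' (q n) \<omega>" for n
        using elim(1) q(1) \<open>\<And>n. q n \<in> {0..}\<close> by blast
      ultimately show "J t \<omega> = J' t \<omega>" by (simp add: LIMSEQ_unique)
    qed
  qed
qed

section \<open>Averages and differences of processes with a common stochastic integral\<close>

text \<open>
  The stochastic integrals of the different \<open>Y i\<close> are versions of one another, hence
  indistinguishable, so in the average of the equations their mean is any one of them.
\<close>

lemma has_ito_differential_average:
  fixes Y :: "'i \<Rightarrow> real \<Rightarrow> 'w \<Rightarrow> real^'n" and H :: "real \<Rightarrow> 'w \<Rightarrow> real^'k^'n"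
  assumes M: "prob_space M" and sub: "\<And>t. subalgebra M (F t)"
    and I: "finite I" "I \<noteq> {}"
    and Y: "\<And>i. i \<in> I \<Longrightarrow> has_ito_differential M F (Y i) (a i) H U"
  shows "has_ito_differential M F (\<lambda>t \<omega>. (1 / real (card I)) *\<^sub>R (\<Sum>i\<in>I. Y i t \<omega>))
    (\<lambda>t \<omega>. (1 / real (card I)) *\<^sub>R (\<Sum>i\<in>I. a i t \<omega>)) H U"
proof -
  let ?n = "real (card I)"
  have n: "?n \<noteq> 0" using I by simp
  have "\<forall>i\<in>I. \<exists>J. has_ito_integral M F H U J \<and>
      (AE \<omega> in M. \<forall>t\<ge>0. (\<lambda>s. a i s \<omega>) absolutely_integrable_on {0..t} \<and>
        Y i t \<omega> = Y i 0 \<omega> + integral {0..t} (\<lambda>s. a i s \<omega>) + J t \<omega>)"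
    using Y unfolding has_ito_differential_def by blast
  from bchoice[OF this] obtain J where J: "\<And>i. i \<in> I \<Longrightarrow> has_ito_integral M F H U (J i)"
    and eq: "\<And>i. i \<in> I \<Longrightarrow> AE \<omega> in M. \<forall>t\<ge>0. (\<lambda>s. a i s \<omega>) absolutely_integrable_on {0..t} \<and>
        Y i t \<omega> = Y i 0 \<omega> + integral {0..t} (\<lambda>s. a i s \<omega>) + J i t \<omega>"
    by blast
  obtain i0 where i0: "i0 \<in> I" using I by blast
  have ad: "adapted F (\<lambda>t \<omega>. (1 / ?n) *\<^sub>R (\<Sum>i\<in>I. Y i t \<omega>))"
    using Y unfolding adapted_def has_ito_differential_def
    by (intro allI impI borel_measurable_scaleR borel_measurable_const borel_measurable_sum) blast
  have "AE \<omega> in M. \<forall>i\<in>I. continuous_on {0..} (\<lambda>t. Y i t \<omega>)"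
    using Y by (intro AE_finite_allI I) (auto simp: has_ito_differential_def continuous_paths_def)
  then have cp: "continuous_paths M (\<lambda>t \<omega>. (1 / ?n) *\<^sub>R (\<Sum>i\<in>I. Y i t \<omega>))"
    unfolding continuous_paths_def by eventually_elim (auto intro!: continuous_intros)
  have "AE \<omega> in M. \<forall>i\<in>I. \<forall>t\<ge>0. J i t \<omega> = J i0 t \<omega>"
    by (intro AE_finite_allI I has_ito_integral_unique[OF M sub J J] i0)
  moreover have "AE \<omega> in M. \<forall>i\<in>I. \<forall>t\<ge>0. (\<lambda>s. a i s \<omega>) absolutely_integrable_on {0..t} \<and>
        Y i t \<omega> = Y i 0 \<omega> + integral {0..t} (\<lambda>s. a i s \<omega>) + J i t \<omega>"
    by (intro AE_finite_allI I eq)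
  ultimately have "AE \<omega> in M. \<forall>t\<ge>0.
      (\<lambda>s. (1 / ?n) *\<^sub>R (\<Sum>i\<in>I. a i s \<omega>)) absolutely_integrable_on {0..t} \<and>
      (1 / ?n) *\<^sub>R (\<Sum>i\<in>I. Y i t \<omega>) = (1 / ?n) *\<^sub>R (\<Sum>i\<in>I. Y i 0 \<omega>) +
        integral {0..t} (\<lambda>s. (1 / ?n) *\<^sub>R (\<Sum>i\<in>I. a i s \<omega>)) + J i0 t \<omega>"
  proof eventually_elim
    case (elim \<omega>)
    show ?case
    proof (intro allI impI conjI)
      fix t :: real assume t: "0 \<le> t"
      have int: "(\<lambda>s. a i s \<omega>) absolutely_integrable_on {0..t}" if "i \<in> I" for i
        using elim(2) that t by blast
      then have int': "(\<lambda>s. a i s \<omega>) integrable_on {0..t}" if "i \<in> I" for i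
        using that by (simp add: absolutely_integrable_on_def)
      show "(\<lambda>s. (1 / ?n) *\<^sub>R (\<Sum>i\<in>I. a i s \<omega>)) absolutely_integrable_on {0..t}"
        by (intro absolutely_integrable_scaleR_left absolutely_integrable_sum I int)
      have "(\<Sum>i\<in>I. Y i t \<omega>) = (\<Sum>i\<in>I. Y i 0 \<omega> + integral {0..t} (\<lambda>s. a i s \<omega>) + J i0 t \<omega>)"
        by (rule sum.cong[OF refl]) (use elim t in \<open>metis (no_types, lifting)\<close>)
      also have "\<dots> = (\<Sum>i\<in>I. Y i 0 \<omega>) + integral {0..t} (\<lambda>s. \<Sum>i\<in>I. a i s \<omega>) + ?n *\<^sub>R J i0 t \<omega>"
        by (simp add: sum.distrib integral_sum[OF I(1) int'] sum_constant_scaleR del: sum_constant)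
      finally show "(1 / ?n) *\<^sub>R (\<Sum>i\<in>I. Y i t \<omega>) = (1 / ?n) *\<^sub>R (\<Sum>i\<in>I. Y i 0 \<omega>) +
          integral {0..t} (\<lambda>s. (1 / ?n) *\<^sub>R (\<Sum>i\<in>I. a i s \<omega>)) + J i0 t \<omega>"
        using n by (simp add: scaleR_add_right)
    qed
  qed
  with ad cp J[OF i0] show ?thesis unfolding has_ito_differential_def by blast
qed

text \<open>
  Processes with the same integrand and integrator share their stochastic integral up to
  indistinguishability, so it cancels in the difference. This is how the stochastic equations of
  the particles give an equation for the deviations that holds path by path.
\<close>

lemma ito_differential_difference:
  fixes Y Y' :: "real \<Rightarrow> 'w \<Rightarrow> real^'n" and H :: "real \<Rightarrow> 'w \<Rightarrow> real^'k^'n"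
  assumes M: "prob_space M" and sub: "\<And>t. subalgebra M (F t)"
    and Y: "has_ito_differential M F Y a H U" and Y': "has_ito_differential M F Y' a' H U"
  shows "AE \<omega> in M. \<forall>t\<ge>0. (\<lambda>s. a s \<omega> - a' s \<omega>) absolutely_integrable_on {0..t} \<and>
    Y t \<omega> - Y' t \<omega> = Y 0 \<omega> - Y' 0 \<omega> + integral {0..t} (\<lambda>s. a s \<omega> - a' s \<omega>)"
proof -
  obtain J where J: "has_ito_integral M F H U J"
    and eq: "AE \<omega> in M. \<forall>t\<ge>0. (\<lambda>s. a s \<omega>) absolutely_integrable_on {0..t} \<and>
        Y t \<omega> = Y 0 \<omega> + integral {0..t} (\<lambda>s. a s \<omega>) + J t \<omega>"
    using Y unfolding has_ito_differential_def by blast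
  obtain J' where J': "has_ito_integral M F H U J'"
    and eq': "AE \<omega> in M. \<forall>t\<ge>0. (\<lambda>s. a' s \<omega>) absolutely_integrable_on {0..t} \<and>
        Y' t \<omega> = Y' 0 \<omega> + integral {0..t} (\<lambda>s. a' s \<omega>) + J' t \<omega>"
    using Y' unfolding has_ito_differential_def by blast
  from has_ito_integral_unique[OF M sub J J'] eq eq' show ?thesis
  proof eventually_elim
    case (elim \<omega>)
    show ?case
    proof (intro allI impI)
      fix t :: real assume t: "0 \<le> t"
      have i: "(\<lambda>s. a s \<omega>) absolutely_integrable_on {0..t}" "(\<lambda>s. a' s \<omega>) absolutely_integrable_on {0..t}"
        using elim t by blast+
      have "integral {0..t} (\<lambda>s. a s \<omega> - a' s \<omega>) = integral {0..t} (\<lambda>s. a s \<omega>) - integral {0..t} (\<lambda>s. a' s \<omega>)"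
        using i by (intro integral_diff) (auto simp: absolutely_integrable_on_def)
      moreover have "Y t \<omega> = Y 0 \<omega> + integral {0..t} (\<lambda>s. a s \<omega>) + J t \<omega>"
        "Y' t \<omega> = Y' 0 \<omega> + integral {0..t} (\<lambda>s. a' s \<omega>) + J' t \<omega>" "J t \<omega> = J' t \<omega>"
        using elim t by blast+
      ultimately show "(\<lambda>s. a s \<omega> - a' s \<omega>) absolutely_integrable_on {0..t} \<and>
          Y t \<omega> - Y' t \<omega> = Y 0 \<omega> - Y' 0 \<omega> + integral {0..t} (\<lambda>s. a s \<omega> - a' s \<omega>)"
        using set_integral_diff(1)[OF i] by (simp only: conj_commute) (simp add: algebra_simps)
    qed
  qed
qed

section \<open>The finite particle filter\<close>

lemma sum_deviation_eq_0: "0 < N \<Longrightarrow> (\<Sum>i=1..N. deviation N X i t \<omega>) = 0"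
  by (simp add: deviation_def emp_mean_def sum_subtractf sum_constant_scaleR del: sum_constant)

theorem mainTheorem2:
  fixes M :: "'w measure" and F :: "real \<Rightarrow> 'w measure"
    and A :: "real^'d^'d" and C :: "real^'d^'m" and \<sigma>\<^sub>B :: "real^'p^'d"
    and m\<^sub>0 :: "real^'d" and \<Sigma>\<^sub>0 :: "real^'d^'d"
    and B :: "real \<Rightarrow> 'w \<Rightarrow> real^'p" and W :: "real \<Rightarrow> 'w \<Rightarrow> real^'m"
    and Xs :: "real \<Rightarrow> 'w \<Rightarrow> real^'d" and Z :: "real \<Rightarrow> 'w \<Rightarrow> real^'m"
    and N :: nat and X :: "nat \<Rightarrow> real \<Rightarrow> 'w \<Rightarrow> real^'d"
    and \<Omega> :: "real \<Rightarrow> 'w \<Rightarrow> real^'d^'d"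
  assumes model: "linear_gaussian_model M F A C \<sigma>\<^sub>B m\<^sub>0 \<Sigma>\<^sub>0 B W Xs Z"
    and detect: "detectable A C" and stabil: "stabilizable A \<sigma>\<^sub>B"
    and N: "N \<ge> 2"
    and init_law: "\<And>i. i \<in> {1..N} \<Longrightarrow> gaussian M (X i 0) m\<^sub>0 \<Sigma>\<^sub>0"
    and init_indep: "prob_space.indep_vars M (\<lambda>_. borel) (\<lambda>i. X i 0) {1..N}"
    and skew: "AE \<omega> in M. \<forall>t\<ge>0. skew (\<Omega> t \<omega>)"
    and particles: "\<And>i. i \<in> {1..N} \<Longrightarrow>
      has_ito_differential M F (X i)
        (\<lambda>t \<omega>. A *v emp_mean N X t \<omega> - gain C (emp_cov N X t \<omega>) *v (C *v emp_mean N X t \<omega>)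
          + flow_matrix A C \<sigma>\<^sub>B (emp_cov N X t \<omega>) (\<Omega> t \<omega>) *v (X i t \<omega> - emp_mean N X t \<omega>))
        (\<lambda>t \<omega>. gain C (emp_cov N X t \<omega>)) Z"
    and init_inv: "AE \<omega> in M. invertible (emp_cov N X 0 \<omega>)"
  shows
    \<comment> \<open>the inverse in the flow matrix exists at all times\<close>
    "(AE \<omega> in M. \<forall>t\<ge>0. invertible (emp_cov N X t \<omega>)) \<and>
    has_ito_differential M F (emp_mean N X)
      (\<lambda>t \<omega>. A *v emp_mean N X t \<omega> - gain C (emp_cov N X t \<omega>) *v (C *v emp_mean N X t \<omega>))
      (\<lambda>t \<omega>. gain C (emp_cov N X t \<omega>)) Z \<and>
    (AE \<omega> in M. \<forall>t\<ge>0.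
      ((\<lambda>s. emp_cov N X s \<omega>) has_vector_derivative
        A ** emp_cov N X t \<omega> + emp_cov N X t \<omega> ** transpose A + \<sigma>\<^sub>B ** transpose \<sigma>\<^sub>B
          - emp_cov N X t \<omega> ** transpose C ** C ** emp_cov N X t \<omega>) (at t within {0..})) \<and>
    \<comment> \<open>no regularity of the skew matrices in time is assumed: the deviation equation holds in
        integrated form, at almost every time, and at every time where they are continuous\<close>
    (\<forall>i\<in>{1..N}. AE \<omega> in M.
      let \<xi> = (\<lambda>t. deviation N X i t \<omega>);
          g = (\<lambda>t. flow_matrix A C \<sigma>\<^sub>B (emp_cov N X t \<omega>) (\<Omega> t \<omega>) *v deviation N X i t \<omega>)
      in (\<forall>t\<ge>0. g absolutely_integrable_on {0..t} \<and> \<xi> t = \<xi> 0 + integral {0..t} g) \<and>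
         (AE t in lborel. 0 \<le> t \<longrightarrow> (\<xi> has_vector_derivative g t) (at t within {0..})) \<and>
         (\<forall>t\<ge>0. continuous (at t within {0..}) (\<lambda>s. \<Omega> s \<omega>) \<longrightarrow>
            (\<xi> has_vector_derivative g t) (at t within {0..}))) \<and>
    kalman_bucy_equations M F A C \<sigma>\<^sub>B Z (emp_mean N X) (emp_cov N X)"
proof -
  have M: "prob_space M" and sub: "\<And>t. subalgebra M (F t)"
    using model by (auto simp: linear_gaussian_model_def filtered_prob_space_def)
  let ?K = "\<lambda>t \<omega>. gain C (emp_cov N X t \<omega>)"
  let ?b = "\<lambda>t \<omega>. A *v emp_mean N X t \<omega> - gain C (emp_cov N X t \<omega>) *v (C *v emp_mean N X t \<omega>)"
  let ?G = "\<lambda>t \<omega>. flow_matrix A C \<sigma>\<^sub>B (emp_cov N X t \<omega>) (\<Omega> t \<omega>)"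
  \<comment> \<open>the feedback term is linear in the deviations, which sum to zero\<close>
  have drift_avg: "(1 / real (card {1..N})) *\<^sub>R (\<Sum>i=1..N. ?b t \<omega> + ?G t \<omega> *v (X i t \<omega> - emp_mean N X t \<omega>)) = ?b t \<omega>" for t \<omega>
  proof -
    have "(\<Sum>i=1..N. ?G t \<omega> *v (X i t \<omega> - emp_mean N X t \<omega>)) = ?G t \<omega> *v (\<Sum>i=1..N. deviation N X i t \<omega>)"
      unfolding deviation_def by (rule linear_sum[OF matrix_vector_mul_linear, symmetric])
    then have "(\<Sum>i=1..N. ?G t \<omega> *v (X i t \<omega> - emp_mean N X t \<omega>)) = 0"
      using sum_deviation_eq_0[of N X t \<omega>] N by (simp only: matrix_vector_mult_0_right)
    then show ?thesis using N by (simp add: sum.distrib sum_constant_scaleR del: sum_constant)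
  qed
  have mean: "has_ito_differential M F (emp_mean N X) ?b ?K Z"
  proof -
    have avg: "has_ito_differential M F (\<lambda>t \<omega>. (1 / real (card {1..N})) *\<^sub>R (\<Sum>i=1..N. X i t \<omega>))
      (\<lambda>t \<omega>. (1 / real (card {1..N})) *\<^sub>R (\<Sum>i=1..N. ?b t \<omega> + ?G t \<omega> *v (X i t \<omega> - emp_mean N X t \<omega>))) ?K Z"
      using N by (intro has_ito_differential_average[OF M sub] particles) auto
    have mean_eq: "(\<lambda>t \<omega>. (1 / real (card {1..N})) *\<^sub>R (\<Sum>i=1..N. X i t \<omega>)) = emp_mean N X"
      by (intro ext) (simp add: emp_mean_def)
    from avg show ?thesis by (simp only: drift_avg mean_eq)
  qed
  have dev: "AE \<omega> in M. \<forall>t\<ge>0.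
      (\<lambda>s. ?G s \<omega> *v deviation N X i s \<omega>) absolutely_integrable_on {0..t} \<and>
      deviation N X i t \<omega> = deviation N X i 0 \<omega> + integral {0..t} (\<lambda>s. ?G s \<omega> *v deviation N X i s \<omega>)"
    if i: "i \<in> {1..N}" for i
    using ito_differential_difference[OF M sub particles[OF i] mean]
    by (simp add: deviation_def)
  have dev_all: "AE \<omega> in M. \<forall>i\<in>{1..N}. \<forall>t\<ge>0.
      (\<lambda>s. ?G s \<omega> *v deviation N X i s \<omega>) absolutely_integrable_on {0..t} \<and>
      deviation N X i t \<omega> = deviation N X i 0 \<omega> + integral {0..t} (\<lambda>s. ?G s \<omega> *v deviation N X i s \<omega>)"
    by (intro AE_finite_allI dev) auto
  have flow: "AE \<omega> in M. deviation_flow A C \<sigma>\<^sub>B {1..N} (1 / (real N - 1))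
      (\<lambda>i t. deviation N X i t \<omega>) (\<lambda>t. emp_cov N X t \<omega>) (\<lambda>t. \<Omega> t \<omega>)"
    using dev_all skew init_inv
  proof eventually_elim
    case (elim \<omega>)
    show ?case
    proof (unfold_locales)
      show "0 \<le> 1 / (real N - 1)" using N by simp
      show "emp_cov N X t \<omega> = (1 / (real N - 1)) *\<^sub>R
          (\<Sum>i=1..N. outer (deviation N X i t \<omega>) (deviation N X i t \<omega>))" for t
        by (simp add: emp_cov_def)
    qed (use elim in blast)+
  qed
  have inv: "AE \<omega> in M. \<forall>t\<ge>0. invertible (emp_cov N X t \<omega>)"
    using flow
  proof eventually_elim
    case (elim \<omega>)
    show ?case using deviation_flow.covariance_invertible[OF elim] by blast
  qed
  have ric: "AE \<omega> in M. \<forall>t\<ge>0. ((\<lambda>s. emp_cov N X s \<omega>) has_vector_derivative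
      riccati A C \<sigma>\<^sub>B (emp_cov N X t \<omega>)) (at t within {0..})"
    using flow
  proof eventually_elim
    case (elim \<omega>)
    show ?case using deviation_flow.covariance_riccati[OF elim] by blast
  qed
  have "AE \<omega> in M.
      let \<xi> = (\<lambda>t. deviation N X i t \<omega>);
          g = (\<lambda>t. flow_matrix A C \<sigma>\<^sub>B (emp_cov N X t \<omega>) (\<Omega> t \<omega>) *v deviation N X i t \<omega>)
      in (\<forall>t\<ge>0. g absolutely_integrable_on {0..t} \<and> \<xi> t = \<xi> 0 + integral {0..t} g) \<and>
         (AE t in lborel. 0 \<le> t \<longrightarrow> (\<xi> has_vector_derivative g t) (at t within {0..})) \<and>
         (\<forall>t\<ge>0. continuous (at t within {0..}) (\<lambda>s. \<Omega> s \<omega>) \<longrightarrow>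
            (\<xi> has_vector_derivative g t) (at t within {0..}))" if i: "i \<in> {1..N}" for i
    using dev[OF i] flow
  proof eventually_elim
    case (elim \<omega>)
    show ?case
      unfolding Let_def
      using elim(1) deviation_flow.deviation_derivative_AE[OF elim(2) i]
        deviation_flow.deviation_derivative_at[OF elim(2) i]
      by blast
  qed
  then show ?thesis
    using inv mean ric unfolding kalman_bucy_equations_def riccati_def by blast
qed

end
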